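(* Let $4\le r\le 8$, let $l$ be a fixed line in a del Pezzo surface $S_r$, and let $V_l$ be the vertex of the Gosset polytope $(r-4)_{21}$ corresponding to $l$. (1) For $4\le r\le 8$, $N_0(l,S_r)$ is bijective to the set of lines $L_{r-1}$ in $S_{r-1}$; equivalently, it is also bijective to the set of vertices of the polytope $(r-5)_{21}$. (2) For $4\le r\le 8$, $N_1(l,S_r)$ is bijective to the set of rulings containing $l$ in $S_r$, which is also bijective to the set of rulings $F_{r-1}$ in $S_{r-1}$. Equivalently, it is also bijective to the set of $(r-1)$-crosspolytopes in $(r-4)_{21}$ containing $V_l$ and to the set of $(r-2)$-crosspolytopes in $(r-5)_{21}$. (3) For $r=8$, $N_2(l,S_8)$ is bijective to $N_0(-2K_{S_8}-l,S_8)$, the set of lines in $S_8$ skew to the line $-2K_{S_8}-l$; equivalently, it is also bijective to the set of lines in $S_7$. (4) $N_2(l,S_7)=\{-K_{S_7}-l\}$ (for $r=7$) and $N_3(l,S_8)=\{-2K_{S_8}-l\}$ (for $r=8$).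
   Context: For $3\le s\le 8$, $S_s$ is a del Pezzo surface obtained by blowing up $\mathbb{P}^2$ at $s$ points in general position. $Pic\,S_s=\mathbb{Z}h\oplus\mathbb{Z}e_1\oplus\dots\oplus\mathbb{Z}e_s$ with $h^2=1$, $h\cdot e_i=0$, $e_i\cdot e_j=-\delta_{ij}$, and $K_{S_s}=-3h+\sum_{i=1}^s e_i$. Lines: $L_s=\{l\in Pic\,S_s\mid l^2=l\cdot K_{S_s}=-1\}$; distinct lines are skew if their intersection is $0$. Rulings: $F_s=\{f\in Pic\,S_s\mid f^2=0,\ K_{S_s}\cdot f=-2\}$. A ruling $f$ contains the line $l$ if $f-l$ is a line (equivalently $f\cdot l=0$). For a line $l$ in $S_s$ and an integer $k$, $N_k(l,S_s)=\{l'\in L_s\mid l'\cdot l=k\}$. The Gosset polytope $(s-4)_{21}$ ($3\le s\le 8$) is the $s$-dimensional semiregular polytope with symmetry group the Coxeter group $E_s$ ($E_3=A_1\times A_2$, $E_4=A_4$, $E_5=D_5$), realized as the convex hull of $L_s$ in $\{D\in Pic\,S_s\otimes\mathbb{Q}\mid -D\cdot K_{S_s}=1\}$ with the Euclidean metric given by minus the intersection form; its vertices are exactly the elements of $L_s$, and a line $l$ viewed as a vertex is denoted $V_l$. Its facets are regular $(s-1)$-simplexes and $(s-1)$-crosspolytopes (a $2$-crosspolytope is a square). *)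

theory Defs
  imports "HOL-Analysis.Analysis" "HOL-Library.Equipollence"
begin

text \<open>
  All the groups \<open>Pic S\<^sub>s\<close> (\<open>s \<le> 8\<close>) are realised inside the one free group \<open>\<int>\<^sup>9\<close>: the index type
  \<open>9\<close> has the elements \<open>0, \<dots>, 8\<close>, where coordinate \<open>0\<close> belongs to \<open>h\<close> and coordinate \<open>i\<close>
  to \<open>e\<^sub>i\<close>. Likewise \<open>Pic S\<^sub>s \<otimes> \<real>\<close> lies in \<open>real ^ 9\<close>. The form is generic in the scalars so
  that it serves both.
\<close>

definition inter :: "'a::comm_ring_1 ^ 9 \<Rightarrow> 'a ^ 9 \<Rightarrow> 'a"  (infixl "\<bullet>\<^sub>P" 70)
  where "C \<bullet>\<^sub>P D = C $ 0 * D $ 0 - (\<Sum>i\<in>UNIV - {0}. C $ i * D $ i)"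

definition hyp :: "int ^ 9"
  where "hyp = axis 0 1"

definition exc :: "nat \<Rightarrow> int ^ 9"
  where "exc i = axis (of_nat i) 1"

definition Pic :: "nat \<Rightarrow> (int ^ 9) set"
  where "Pic s = {D. \<exists>a b. D = a *s hyp + (\<Sum>i=1..s. b i *s exc i)}"

definition canon :: "nat \<Rightarrow> int ^ 9"
  where "canon s = - (3 *s hyp) + (\<Sum>i=1..s. exc i)"

definition lines :: "nat \<Rightarrow> (int ^ 9) set"
  where "lines s = {l \<in> Pic s. l \<bullet>\<^sub>P l = -1 \<and> l \<bullet>\<^sub>P canon s = -1}"

definition skew :: "int ^ 9 \<Rightarrow> int ^ 9 \<Rightarrow> bool"
  where "skew l l' \<longleftrightarrow> l \<noteq> l' \<and> l \<bullet>\<^sub>P l' = 0"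

definition rulings :: "nat \<Rightarrow> (int ^ 9) set"
  where "rulings s = {f \<in> Pic s. f \<bullet>\<^sub>P f = 0 \<and> canon s \<bullet>\<^sub>P f = -2}"

definition ruling_contains :: "nat \<Rightarrow> int ^ 9 \<Rightarrow> int ^ 9 \<Rightarrow> bool"
  where "ruling_contains s f l \<longleftrightarrow> f - l \<in> lines s"

definition N :: "int \<Rightarrow> int ^ 9 \<Rightarrow> nat \<Rightarrow> (int ^ 9) set"
  where "N k l s = {l' \<in> lines s. l' \<bullet>\<^sub>P l = k}"

definition vertex :: "int ^ 9 \<Rightarrow> real ^ 9"
  where "vertex D = (\<chi> i. of_int (D $ i))"

text \<open>\<open>gosset s\<close> is the polytope \<open>(s - 4)\<^sub>2\<^sub>1\<close>.\<close>

definition gosset :: "nat \<Rightarrow> (real ^ 9) set"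
  where "gosset s = convex hull (vertex ` lines s)"

text \<open>
  Regular \<open>d\<close>-crosspolytopes with centre \<open>c\<close> and semi-axes \<open>v 0, \<dots>, v (d - 1)\<close>. Orthogonality and
  length are those of minus the intersection form, not of the standard inner product on
  \<open>real ^ 9\<close>. Minus the intersection form is indefinite on \<open>real ^ 9\<close>, but for \<open>s \<le> 8\<close> it is
  positive definite on the directions \<open>D\<close> of the affine hull of \<open>gosset s\<close>, where
  \<open>D \<bullet>\<^sub>P K = 0\<close>; the semi-axes of a crosspolytope contained in \<open>gosset s\<close> are such directions.
\<close>

definition crosspolytope :: "nat \<Rightarrow> (real ^ 9) set \<Rightarrow> bool"
  where "crosspolytope d X \<longleftrightarrow>
    (\<exists>c v \<rho>. \<rho> > 0 \<and>
      (\<forall>i<d. \<forall>j<d. - (v i \<bullet>\<^sub>P v j) = (if i = j then \<rho> else 0)) \<and>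
      X = convex hull ((\<lambda>i. c + v i) ` {..<d} \<union> (\<lambda>i. c - v i) ` {..<d}))"

definition crosspolytope_facets :: "nat \<Rightarrow> (real ^ 9) set set"
  where "crosspolytope_facets s = {X. X facet_of gosset s \<and> crosspolytope (s - 1) X}"

lemma inter_axis:
  "(axis a 1 :: int ^ 9) \<bullet>\<^sub>P axis b 1 = (if a = b then if a = 0 then 1 else -1 else 0)"
proof -
  have "(\<Sum>k\<in>UNIV - {0}. (axis a 1 :: int ^ 9) $ k * axis b 1 $ k)
      = (\<Sum>k\<in>UNIV - {0}. if k = a then (if a = b then 1 else 0) else 0)"
    by (rule sum.cong) (auto simp: axis_def)
  also have "\<dots> = (if a \<noteq> 0 \<and> a = b then 1 else 0)"
    by (subst sum.delta) auto
  finally show ?thesis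
    by (simp only: inter_def) (auto simp: axis_def)
qed

lemma of_nat_9_eq_iff:
  assumes "i \<le> 8" "j \<le> 8"
  shows "(of_nat i :: 9) = of_nat j \<longleftrightarrow> i = j"
proof -
  have *: "m = n" if "m \<le> n" "n \<le> 8" "(of_nat m :: 9) = of_nat n" for m n
  proof -
    have "(of_nat (n - m) :: 9) = 0"
      using that by (simp add: of_nat_diff)
    then have "9 dvd n - m"
      by (simp add: of_nat_eq_0_iff_char_dvd)
    then show ?thesis
      using that by (auto dest: dvd_imp_le)
  qed
  show ?thesis
    using *[of i j] *[of j i] assms by (metis nat_le_linear)
qed

lemma inter_hyp_hyp: "hyp \<bullet>\<^sub>P hyp = 1"
  by (simp add: hyp_def inter_axis)

lemma inter_hyp_exc:
  assumes "i \<in> {1..8}"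
  shows "hyp \<bullet>\<^sub>P exc i = 0"
  using assms of_nat_9_eq_iff[of 0 i] by (simp only: hyp_def exc_def inter_axis) auto

lemma inter_exc_exc:
  assumes "i \<in> {1..8}" "j \<in> {1..8}"
  shows "exc i \<bullet>\<^sub>P exc j = (if i = j then -1 else 0)"
  using assms of_nat_9_eq_iff[of i 0] of_nat_9_eq_iff[of i j]
  by (simp only: exc_def inter_axis) auto

end

theory Submission
  imports Defs
begin

text \<open>
  Two facts about the lattice carry the proof.

  The first is the Hodge index theorem (\<open>hodge_index\<close>): for \<open>s \<le> 8\<close> the form is negative definite
  on the classes orthogonal to \<open>K\<close>. Applied to small integral combinations such as \<open>l - l'\<close>,
  \<open>f - 2l\<close> or \<open>(9 - s)(l + l') + 2K\<close> it gives all numerical bounds: distinct lines meet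
  nonnegatively and at most \<open>1 + 2 / (9 - s)\<close> times, with \<open>l + l'\<close> a multiple of \<open>K\<close> when this
  maximum is attained; rulings meet lines nonnegatively; and two rulings with intersection number
  \<open>0\<close> agree. The maximal case is part (4), and part (3) follows because
  \<open>l' \<sqdot> (-2K - l) = 2 - l' \<sqdot> l\<close>.

  The second is that the Weyl group acts transitively on lines and on rulings
  (\<open>line_isometric_exc\<close>, \<open>ruling_isometric_hyp_diff_exc\<close>). By Noether's inequality a quadratic
  Cremona reflection lowers the degree of any line or ruling that is not yet
  one of the \<open>e\<^sub>i\<close> or \<open>h - e\<^sub>i\<close>. A line
  may therefore be taken to be \<open>e\<^sub>r\<close>, and the classes of \<open>Pic S\<^sub>r\<close> orthogonal to \<open>e\<^sub>r\<close> form
  \<open>Pic S\<^sub>r\<^sub>-\<^sub>1\<close>, with \<open>K\<^sub>r\<close> and \<open>K\<^sub>r\<^sub>-\<^sub>1\<close> inducing the same degree there. This yields (1) and, since a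
  ruling contains \<open>l\<close> exactly when it is orthogonal to \<open>l\<close>, also the lattice half of (2).

  For the polytopes, a ruling \<open>f\<close> is a linear functional that is nonnegative on the vertices of
  the Gosset polytope, so its zero locus cuts out a face. The lines in it come in pairs
  \<open>L\<^sub>i, f - L\<^sub>i\<close> with the \<open>L\<^sub>i\<close> pairwise skew, so the face is a crosspolytope with centre \<open>f / 2\<close>.
  Conversely, opposite vertices of a crosspolytope facet add up to one class, which the
  intersection numbers force to be either a ruling or \<open>-2K\<close> with \<open>s = 8\<close>; in the latter case the
  facet would contain the centre of symmetry \<open>-K\<close> of the whole polytope. So rulings correspond to
  crosspolytope facets (\<open>bij_betw_ruling_face\<close>).
\<close>

section \<open>Algebra of the intersection form\<close>

lemma inter_commute: "C \<bullet>\<^sub>P D = D \<bullet>\<^sub>P C"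
  by (simp add: inter_def mult.commute)

lemma inter_add_left: "(C + C') \<bullet>\<^sub>P D = C \<bullet>\<^sub>P D + C' \<bullet>\<^sub>P D"
  by (simp add: inter_def algebra_simps sum.distrib)

lemma inter_scale_left: "(a *s C) \<bullet>\<^sub>P D = a * (C \<bullet>\<^sub>P D)"
  by (simp add: inter_def algebra_simps sum_distrib_left)

lemma inter_minus_left: "(- C) \<bullet>\<^sub>P D = - (C \<bullet>\<^sub>P D)"
  by (simp add: inter_def sum_negf)

lemma inter_diff_left: "(C - C') \<bullet>\<^sub>P D = C \<bullet>\<^sub>P D - C' \<bullet>\<^sub>P D"
  using inter_add_left[of C "- C'" D] by (simp add: inter_minus_left)

lemma inter_zero_left: "0 \<bullet>\<^sub>P D = 0"
  by (simp add: inter_def)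

lemma inter_sum_left: "(\<Sum>i\<in>A. C i) \<bullet>\<^sub>P D = (\<Sum>i\<in>A. C i \<bullet>\<^sub>P D)"
  by (induction A rule: infinite_finite_induct) (simp_all add: inter_zero_left inter_add_left)

lemma inter_scaleR_left: "(a *\<^sub>R C) \<bullet>\<^sub>P D = a * (C \<bullet>\<^sub>P D)"
  using inter_scale_left[of a C D] by (simp add: scalar_mult_eq_scaleR)

lemmas inter_left = inter_add_left inter_diff_left inter_minus_left inter_scale_left
  inter_scaleR_left inter_zero_left

lemma inter_add_right: "D \<bullet>\<^sub>P (C + C') = D \<bullet>\<^sub>P C + D \<bullet>\<^sub>P C'"
  and inter_diff_right: "D \<bullet>\<^sub>P (C - C') = D \<bullet>\<^sub>P C - D \<bullet>\<^sub>P C'"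
  and inter_minus_right: "D \<bullet>\<^sub>P (- C) = - (D \<bullet>\<^sub>P C)"
  and inter_scale_right: "D \<bullet>\<^sub>P (a *s C) = a * (D \<bullet>\<^sub>P C)"
  and inter_sum_right: "D \<bullet>\<^sub>P (\<Sum>i\<in>A. B i) = (\<Sum>i\<in>A. D \<bullet>\<^sub>P B i)"
  by (simp_all add: inter_commute[of D] inter_left inter_sum_left)

lemma inter_scaleR_right: "D \<bullet>\<^sub>P (a *\<^sub>R C) = a * (D \<bullet>\<^sub>P C)"
  by (simp add: inter_commute[of D] inter_left)

lemmas inter_right = inter_add_right inter_diff_right inter_minus_right inter_scale_right
  inter_scaleR_right

lemmas inter_bilinear = inter_left inter_right

section \<open>Coordinates on the Picard groups\<close>

lemma Pic_add: "C \<in> Pic s \<Longrightarrow> D \<in> Pic s \<Longrightarrow> C + D \<in> Pic s"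
proof -
  assume "C \<in> Pic s" "D \<in> Pic s"
  then obtain a b a' b' where
    "C = a *s hyp + (\<Sum>i=1..s. b i *s exc i)" "D = a' *s hyp + (\<Sum>i=1..s. b' i *s exc i)"
    unfolding Pic_def by blast
  then have "C + D = (a + a') *s hyp + (\<Sum>i=1..s. (b i + b' i) *s exc i)"
    by (simp add: vector_sadd_rdistrib sum.distrib)
  then show ?thesis
    unfolding Pic_def by (intro CollectI exI)
qed

lemma Pic_scale: "D \<in> Pic s \<Longrightarrow> k *s D \<in> Pic s"
proof -
  assume "D \<in> Pic s"
  then obtain a b where "D = a *s hyp + (\<Sum>i=1..s. b i *s exc i)"
    unfolding Pic_def by blast
  then have "k *s D = (k * a) *s hyp + (\<Sum>i=1..s. (k * b i) *s exc i)"
    by (simp add: vec_eq_iff sum_distrib_left algebra_simps)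
  then show ?thesis
    unfolding Pic_def by (intro CollectI exI)
qed

lemma Pic_minus: "D \<in> Pic s \<Longrightarrow> - D \<in> Pic s"
  using Pic_scale[of D s "-1"] by (simp add: vector_sneg_minus1)

lemma Pic_diff: "C \<in> Pic s \<Longrightarrow> D \<in> Pic s \<Longrightarrow> C - D \<in> Pic s"
  using Pic_add[of C s "- D"] Pic_minus by simp

lemma Pic_sum: "(\<And>i. i \<in> A \<Longrightarrow> C i \<in> Pic s) \<Longrightarrow> (\<Sum>i\<in>A. C i) \<in> Pic s"
proof (induction A rule: infinite_finite_induct)
  case (insert x F)
  then show ?case by (simp add: Pic_add)
qed (auto simp: Pic_def intro!: exI[of _ 0] exI[of _ "\<lambda>_. 0"])

lemma hyp_in_Pic: "hyp \<in> Pic s"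
  unfolding Pic_def by (intro CollectI exI[of _ 1] exI[of _ "\<lambda>_. 0"]) simp

lemma exc_in_Pic:
  assumes "i \<in> {1..s}"
  shows "exc i \<in> Pic s"
proof -
  have "(\<Sum>j=1..s. (if j = i then 1 else 0) *s exc j) = (\<Sum>j=1..s. if j = i then exc j else 0)"
    by (rule sum.cong) auto
  also have "\<dots> = exc i"
    using assms by simp
  finally show ?thesis
    unfolding Pic_def by (intro CollectI exI[of _ 0] exI[of _ "\<lambda>j. if j = i then 1 else 0"]) simp
qed

lemma canon_in_Pic: "canon s \<in> Pic s"
  unfolding canon_def by (intro Pic_add Pic_minus Pic_scale Pic_sum hyp_in_Pic exc_in_Pic)

lemmas Pic_intros = Pic_add Pic_minus Pic_diff Pic_scale hyp_in_Pic exc_in_Pic canon_in_Pic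

lemma inter_exc_hyp: "i \<in> {1..8} \<Longrightarrow> exc i \<bullet>\<^sub>P hyp = 0"
  using inter_hyp_exc by (simp add: inter_commute)

lemma Pic_expand:
  assumes "D \<in> Pic s" "s \<le> 8"
  shows "D = (D \<bullet>\<^sub>P hyp) *s hyp - (\<Sum>i=1..s. (D \<bullet>\<^sub>P exc i) *s exc i)"
proof -
  obtain a b where D: "D = a *s hyp + (\<Sum>i=1..s. b i *s exc i)"
    using assms unfolding Pic_def by blast
  have "(\<Sum>i=1..s. b i * (exc i \<bullet>\<^sub>P hyp)) = 0"
    using assms by (intro sum.neutral) (simp add: inter_exc_hyp)
  then have a: "D \<bullet>\<^sub>P hyp = a"
    by (simp add: D inter_left inter_sum_left inter_hyp_hyp)
  have b: "D \<bullet>\<^sub>P exc j = - b j" if j: "j \<in> {1..s}" for j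
  proof -
    have "(\<Sum>i=1..s. b i * (exc i \<bullet>\<^sub>P exc j)) = (\<Sum>i=1..s. if i = j then - b j else 0)"
      using j assms by (intro sum.cong) (auto simp: inter_exc_exc)
    then show ?thesis
      using j assms by (simp add: D inter_left inter_sum_left inter_hyp_exc)
  qed
  have "(\<Sum>i=1..s. (D \<bullet>\<^sub>P exc i) *s exc i) = - (\<Sum>i=1..s. b i *s exc i)"
    unfolding sum_negf[symmetric] by (intro sum.cong) (auto simp: b vec_eq_iff)
  then show ?thesis
    unfolding a by (simp add: D)
qed

lemma inter_expand:
  assumes "D \<in> Pic s" "s \<le> 8"
  shows "C \<bullet>\<^sub>P D = (C \<bullet>\<^sub>P hyp) * (D \<bullet>\<^sub>P hyp) - (\<Sum>i=1..s. (C \<bullet>\<^sub>P exc i) * (D \<bullet>\<^sub>P exc i))"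
  by (subst Pic_expand[OF assms]) (simp add: inter_right inter_sum_right mult.commute)

lemma inter_canon: "C \<bullet>\<^sub>P canon s = (\<Sum>i=1..s. C \<bullet>\<^sub>P exc i) - 3 * (C \<bullet>\<^sub>P hyp)"
  unfolding canon_def by (simp add: inter_right inter_sum_right)

lemma hyp_canon: "s \<le> 8 \<Longrightarrow> hyp \<bullet>\<^sub>P canon s = -3"
  by (simp add: inter_canon inter_hyp_hyp inter_hyp_exc)

lemma exc_canon: 
  assumes "i \<in> {1..s}" "s \<le> 8" 
  shows "exc i \<bullet>\<^sub>P canon s = -1"
proof -
  have "(\<Sum>j=1..s. exc i \<bullet>\<^sub>P exc j) = (\<Sum>j=1..s. if j = i then -1 else 0)"
    using assms by (intro sum.cong) (auto simp: inter_exc_exc)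
  then show ?thesis
    using assms by (simp add: inter_canon inter_exc_hyp)
qed

lemma canon_canon: 
  assumes "s \<le> 8" 
  shows "canon s \<bullet>\<^sub>P canon s = 9 - int s"
proof -
  have "(\<Sum>i=1..s. canon s \<bullet>\<^sub>P exc i) = (\<Sum>i=1..s. -1)"
    using assms exc_canon by (intro sum.cong) (auto simp: inter_commute)
  then show ?thesis
    using assms hyp_canon[of s] by (simp add: inter_canon[of "canon s"] inter_commute)
qed

text \<open>
  Orthogonality to \<open>K\<close> reads \<open>3d = \<Sum> m\<^sub>i\<close>, so \<open>9d\<^sup>2 \<le> s \<Sum> m\<^sub>i\<^sup>2\<close> by Cauchy-Schwarz, and \<open>s < 9\<close> leaves
  room to spare.
\<close>

lemma hodge_index:
  assumes "D \<in> Pic s" "s \<le> 8" "D \<bullet>\<^sub>P canon s = 0"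
  shows "D \<bullet>\<^sub>P D \<le> 0" and "D \<bullet>\<^sub>P D = 0 \<Longrightarrow> D = 0"
proof -
  define d where "d = D \<bullet>\<^sub>P hyp"
  define m where "m i = D \<bullet>\<^sub>P exc i" for i
  define q where "q = (\<Sum>i=1..s. (m i)\<^sup>2)"
  have sq: "D \<bullet>\<^sub>P D = d\<^sup>2 - q"
    using inter_expand[OF assms(1,2), of D] by (simp add: d_def m_def q_def power2_eq_square)
  have "(\<Sum>i=1..s. m i) = 3 * d"
    using assms(3) by (simp add: inter_canon d_def m_def)
  moreover have "real_of_int ((\<Sum>i=1..s. m i)\<^sup>2) \<le> of_int ((\<Sum>i=1..s. (m i)\<^sup>2) * int s)"
    using Cauchy_Schwarz_ineq_sum[of m "\<lambda>_. 1" "{1..s}"] by simp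
  ultimately have "9 * d\<^sup>2 \<le> int s * q"
    unfolding of_int_le_iff by (simp add: q_def power_mult_distrib mult.commute)
  moreover have q0: "q \<ge> 0"
    unfolding q_def by (intro sum_nonneg) auto
  then have "int s * q \<le> 8 * q"
    using assms(2) by (intro mult_right_mono) auto
  ultimately have le: "9 * d\<^sup>2 \<le> 8 * q"
    by linarith
  then show "D \<bullet>\<^sub>P D \<le> 0"
    using sq q0 by linarith
  assume "D \<bullet>\<^sub>P D = 0"
  then have "q = 0" "d = 0"
    using sq le q0 zero_le_power2[of d] by (linarith, auto)
  then have "D \<bullet>\<^sub>P hyp = 0" and "\<forall>i\<in>{1..s}. D \<bullet>\<^sub>P exc i = 0"
    unfolding q_def d_def m_def by (auto simp: sum_nonneg_eq_0_iff)
  then show "D = 0"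
    by (subst Pic_expand[OF assms(1,2)]) simp
qed

section \<open>Intersection numbers of lines and rulings\<close>

lemma linesD:
  assumes "l \<in> lines s"
  shows "l \<in> Pic s" "l \<bullet>\<^sub>P l = -1" "l \<bullet>\<^sub>P canon s = -1"
  using assms by (auto simp: lines_def)

lemma rulings_iff: "f \<in> rulings s \<longleftrightarrow> f \<in> Pic s \<and> f \<bullet>\<^sub>P f = 0 \<and> f \<bullet>\<^sub>P canon s = -2"
  by (auto simp: rulings_def inter_commute)

lemma rulingsD:
  assumes "f \<in> rulings s"
  shows "f \<in> Pic s" "f \<bullet>\<^sub>P f = 0" "f \<bullet>\<^sub>P canon s = -2"
  using assms by (auto simp: rulings_iff)

text \<open>
  The class \<open>l - l'\<close> is orthogonal to \<open>K\<close> and has square \<open>-2 - 2 (l \<sqdot> l')\<close>.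
\<close>

lemma line_line_ge:
  assumes "s \<le> 8" "l \<in> lines s" "l' \<in> lines s"
  shows "l \<bullet>\<^sub>P l' \<ge> -1" and "l \<bullet>\<^sub>P l' = -1 \<Longrightarrow> l = l'"
proof -
  note l = linesD[OF assms(2)] linesD[OF assms(3)]
  have D: "l - l' \<in> Pic s" "(l - l') \<bullet>\<^sub>P canon s = 0"
    using l by (auto simp: Pic_intros inter_bilinear)
  have "(l - l') \<bullet>\<^sub>P (l - l') = -2 - 2 * (l \<bullet>\<^sub>P l')"
    using l by (simp add: inter_bilinear inter_commute[of l' l])
  then show "l \<bullet>\<^sub>P l' \<ge> -1" "l \<bullet>\<^sub>P l' = -1 \<Longrightarrow> l = l'"
    using hodge_index[OF D(1) assms(1) D(2)] by auto
qed

lemma line_line_nonneg: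
  assumes "s \<le> 8" "l \<in> lines s" "l' \<in> lines s" "l \<noteq> l'"
  shows "l \<bullet>\<^sub>P l' \<ge> 0"
  using line_line_ge[OF assms(1-3)] assms(4) by linarith

text \<open>
  The factor \<open>9 - s = K\<^sup>2\<close> makes \<open>(9 - s)(l + l') + 2K\<close>, a multiple of the projection of \<open>l + l'\<close>
  to the orthogonal complement of \<open>K\<close>, integral.
\<close>

lemma line_line_le:
  assumes "s \<le> 8" "l \<in> lines s" "l' \<in> lines s"
  shows "(9 - int s) * (l \<bullet>\<^sub>P l' - 1) \<le> 2"
    and "(9 - int s) * (l \<bullet>\<^sub>P l' - 1) = 2 \<Longrightarrow> (9 - int s) *s (l + l') = - (2 *s canon s)"
proof -
  note l = linesD[OF assms(2)] linesD[OF assms(3)]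
  define n where "n = 9 - int s"
  have n: "n > 0" and K: "canon s \<bullet>\<^sub>P canon s = n"
    using assms(1) canon_canon by (auto simp: n_def)
  define D where "D = n *s (l + l') + 2 *s canon s"
  have D: "D \<in> Pic s" "D \<bullet>\<^sub>P canon s = 0"
    using l K by (auto simp: D_def Pic_intros inter_bilinear)
  have DD: "D \<bullet>\<^sub>P D = 2 * n * (n * (l \<bullet>\<^sub>P l' - 1) - 2)"
    using l K by (simp add: D_def inter_bilinear inter_commute[of l' l]
        inter_commute[of "canon s" l] inter_commute[of "canon s" l'] algebra_simps)
  then have "n * (n * (l \<bullet>\<^sub>P l' - 1) - 2) \<le> 0"
    using hodge_index(1)[OF D(1) assms(1) D(2)] by simp
  then show "(9 - int s) * (l \<bullet>\<^sub>P l' - 1) \<le> 2"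
    using n by (simp add: mult_le_0_iff n_def)
  assume "(9 - int s) * (l \<bullet>\<^sub>P l' - 1) = 2"
  then have "D = 0"
    using hodge_index(2)[OF D(1) assms(1) D(2)] DD by (simp add: n_def)
  then show "(9 - int s) *s (l + l') = - (2 *s canon s)"
    unfolding D_def n_def by (simp add: eq_neg_iff_add_eq_0)
qed

lemma line_line_le_3:
  assumes "s \<le> 8" "l \<in> lines s" "l' \<in> lines s"
  shows "l \<bullet>\<^sub>P l' \<le> 3"
proof (rule ccontr)
  assume "\<not> l \<bullet>\<^sub>P l' \<le> 3"
  then have "1 * 3 \<le> (9 - int s) * (l \<bullet>\<^sub>P l' - 1)"
    using assms(1) by (intro mult_mono) auto
  then show False
    using line_line_le(1)[OF assms] by linarith
qed

lemma line_line_eq_3: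
  assumes "s \<le> 8" "l \<in> lines s" "l' \<in> lines s" "l \<bullet>\<^sub>P l' = 3"
  shows "s = 8" and "l + l' = - (2 *s canon s)"
proof -
  show s: "s = 8"
    using line_line_le(1)[OF assms(1-3)] assms(1,4) by simp
  show "l + l' = - (2 *s canon s)"
    using line_line_le(2)[OF assms(1-3)] assms(4) s by simp
qed

text \<open>
  The class \<open>f - 2l\<close> is orthogonal to \<open>K\<close> and has square \<open>-4 (f \<sqdot> l) - 4\<close>, so only \<open>f \<sqdot> l = -1\<close>
  has to be excluded; it would force \<open>f = 2l\<close>, hence \<open>f \<sqdot> l = -2\<close>.
\<close>

lemma ruling_line_nonneg:
  assumes "s \<le> 8" "f \<in> rulings s" "l \<in> lines s"
  shows "f \<bullet>\<^sub>P l \<ge> 0"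
proof -
  note fl = rulingsD[OF assms(2)] linesD[OF assms(3)]
  have D: "f - 2 *s l \<in> Pic s" "(f - 2 *s l) \<bullet>\<^sub>P canon s = 0"
    using fl by (auto simp: Pic_intros inter_bilinear)
  have DD: "(f - 2 *s l) \<bullet>\<^sub>P (f - 2 *s l) = - 4 * (f \<bullet>\<^sub>P l) - 4"
    using fl by (simp add: inter_bilinear inter_commute[of l f])
  have "f \<bullet>\<^sub>P l \<noteq> -1"
  proof
    assume "f \<bullet>\<^sub>P l = -1"
    then have "f - 2 *s l = 0"
      using hodge_index(2)[OF D(1) assms(1) D(2)] DD by simp
    then have "(f - 2 *s l) \<bullet>\<^sub>P l = 0"
      by (simp add: inter_zero_left)
    then show False
      using \<open>f \<bullet>\<^sub>P l = -1\<close> fl by (simp add: inter_bilinear)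
  qed
  then show ?thesis
    using hodge_index(1)[OF D(1) assms(1) D(2)] DD by linarith
qed

text \<open>
  The class \<open>f - g\<close> is orthogonal to \<open>K\<close> and isotropic.
\<close>

lemma rulings_eqI:
  assumes "s \<le> 8" "f \<in> rulings s" "g \<in> rulings s" "f \<bullet>\<^sub>P g = 0"
  shows "f = g"
proof -
  note fg = rulingsD[OF assms(2)] rulingsD[OF assms(3)]
  have "f - g \<in> Pic s" "(f - g) \<bullet>\<^sub>P canon s = 0" "(f - g) \<bullet>\<^sub>P (f - g) = 0"
    using fg assms(4) by (auto simp: Pic_intros inter_bilinear inter_commute[of g f])
  then show ?thesis
    using hodge_index(2)[of "f - g" s] assms(1) by simp
qed

lemma ruling_contains_iff:
  assumes "f \<in> rulings s" "l \<in> lines s"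
  shows "ruling_contains s f l \<longleftrightarrow> f \<bullet>\<^sub>P l = 0"
  using rulingsD[OF assms(1)] linesD[OF assms(2)]
  by (auto simp: ruling_contains_def lines_def Pic_intros inter_bilinear inter_commute[of l f])

lemma line_add_line_ruling:
  assumes "l \<in> lines s" "l' \<in> lines s" "l \<bullet>\<^sub>P l' = 1"
  shows "l + l' \<in> rulings s"
  using linesD[OF assms(1)] linesD[OF assms(2)] assms(3)
  by (auto simp: rulings_iff Pic_intros inter_bilinear inter_commute[of l' l])

lemma exc_line: "i \<in> {1..s} \<Longrightarrow> s \<le> 8 \<Longrightarrow> exc i \<in> lines s"
  by (auto simp: lines_def Pic_intros inter_exc_exc exc_canon)

lemma hyp_diff_exc_ruling:
  assumes "i \<in> {1..s}" "s \<le> 8"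
  shows "hyp - exc i \<in> rulings s"
  using assms by (auto simp: rulings_iff Pic_intros inter_bilinear inter_exc_exc exc_canon
      inter_exc_hyp inter_hyp_exc inter_hyp_hyp hyp_canon)

lemma hyp_diff_exc_exc_line:
  assumes "i \<in> {1..s}" "j \<in> {1..s}" "i \<noteq> j" "s \<le> 8"
  shows "hyp - exc i - exc j \<in> lines s"
  using assms by (auto simp: lines_def Pic_intros inter_bilinear inter_exc_exc exc_canon
      inter_exc_hyp inter_hyp_exc inter_hyp_hyp hyp_canon)

section \<open>Transitivity of the Weyl group\<close>

text \<open>
  Lines, rulings and their incidences are cut out by intersection numbers alone, so a bijection
  that preserves these numbers transports all of them.
\<close>

definition pic_isometry :: "nat \<Rightarrow> (int ^ 9 \<Rightarrow> int ^ 9) \<Rightarrow> bool"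
  where "pic_isometry s \<phi> \<longleftrightarrow> bij_betw \<phi> (Pic s) (Pic s) \<and> \<phi> (canon s) = canon s \<and>
    (\<forall>C\<in>Pic s. \<forall>D\<in>Pic s. \<phi> C \<bullet>\<^sub>P \<phi> D = C \<bullet>\<^sub>P D)"

lemma pic_isometry_id: "pic_isometry s (\<lambda>D. D)"
  by (simp add: pic_isometry_def bij_betw_def inj_on_def)

lemma pic_isometry_comp:
  assumes "pic_isometry s \<phi>" "pic_isometry s \<psi>"
  shows "pic_isometry s (\<lambda>D. \<psi> (\<phi> D))"
  using assms bij_betw_trans[of \<phi> "Pic s" "Pic s" \<psi> "Pic s"] bij_betwE[of \<phi> "Pic s" "Pic s"]
  unfolding pic_isometry_def comp_def by auto

lemma bij_betw_subset_filter:
  assumes "bij_betw h A B" "\<And>x. x \<in> A \<Longrightarrow> Q (h x) \<longleftrightarrow> P x"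
  shows "bij_betw h {x \<in> A. P x} {y \<in> B. Q y}"
proof -
  have "h ` {x \<in> A. P x} = {y \<in> B. Q y}"
    using assms bij_betw_imp_surj_on[OF assms(1)] by auto
  then show ?thesis
    using assms(1) by (auto simp: bij_betw_def intro: inj_on_subset)
qed

lemma bij_betw_pic_isometry:
  assumes \<phi>: "pic_isometry s \<phi>" and E: "E \<in> Pic s"
  shows "bij_betw \<phi> {D \<in> Pic s. P (D \<bullet>\<^sub>P D) (D \<bullet>\<^sub>P canon s) (D \<bullet>\<^sub>P E)}
    {D \<in> Pic s. P (D \<bullet>\<^sub>P D) (D \<bullet>\<^sub>P canon s) (D \<bullet>\<^sub>P \<phi> E)}"
proof -
  have "(\<phi> D \<bullet>\<^sub>P \<phi> D, \<phi> D \<bullet>\<^sub>P canon s, \<phi> D \<bullet>\<^sub>P \<phi> E) = (D \<bullet>\<^sub>P D, D \<bullet>\<^sub>P canon s, D \<bullet>\<^sub>P E)"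
    if "D \<in> Pic s" for D
    using \<phi> E that canon_in_Pic[of s] unfolding pic_isometry_def by (metis (no_types))
  moreover have "bij_betw \<phi> (Pic s) (Pic s)"
    using \<phi> by (simp add: pic_isometry_def)
  ultimately show ?thesis
    by (intro bij_betw_subset_filter) auto
qed

lemma lines_isometry:
  assumes "pic_isometry s \<phi>" "l \<in> lines s"
  shows "\<phi> l \<in> lines s"
  using bij_betw_pic_isometry[OF assms(1) canon_in_Pic, of "\<lambda>a b c. a = -1 \<and> b = -1"] assms(2)
  unfolding lines_def by (auto dest: bij_betwE)

lemma rulings_isometry:
  assumes "pic_isometry s \<phi>" "f \<in> rulings s"
  shows "\<phi> f \<in> rulings s"
  using bij_betw_pic_isometry[OF assms(1) canon_in_Pic, of "\<lambda>a b c. a = 0 \<and> b = -2"] assms(2)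
  unfolding rulings_iff by (auto dest: bij_betwE)

text \<open>For a root, \<open>\<alpha>\<^sup>2 = -2\<close>, this is the orthogonal reflection \<open>\<alpha> \<mapsto> -\<alpha>\<close>.\<close>

definition reflection :: "int ^ 9 \<Rightarrow> int ^ 9 \<Rightarrow> int ^ 9"
  where "reflection \<alpha> D = D + (D \<bullet>\<^sub>P \<alpha>) *s \<alpha>"

lemma pic_isometry_reflection:
  assumes "\<alpha> \<in> Pic s" "\<alpha> \<bullet>\<^sub>P \<alpha> = -2" "\<alpha> \<bullet>\<^sub>P canon s = 0"
  shows "pic_isometry s (reflection \<alpha>)"
proof -
  have "reflection \<alpha> (reflection \<alpha> D) = D" for D
    using assms(2) by (simp add: reflection_def inter_bilinear vec_eq_iff algebra_simps)
  moreover have "reflection \<alpha> D \<in> Pic s" if "D \<in> Pic s" for D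
    using assms(1) that by (simp add: reflection_def Pic_intros)
  ultimately have "bij_betw (reflection \<alpha>) (Pic s) (Pic s)"
    by (intro bij_betw_byWitness[where f' = "reflection \<alpha>"]) auto
  moreover have "reflection \<alpha> C \<bullet>\<^sub>P reflection \<alpha> D = C \<bullet>\<^sub>P D" for C D
    using assms(2) by (simp add: reflection_def inter_bilinear inter_commute[of \<alpha> D] algebra_simps)
  moreover have "reflection \<alpha> (canon s) = canon s"
    using assms(3) by (simp add: reflection_def inter_commute[of "canon s"])
  ultimately show ?thesis
    by (simp add: pic_isometry_def)
qed

text \<open>
  If \<open>l\<close> and \<open>l'\<close> are skew, \<open>l - l'\<close> is a root, and its reflection exchanges the two lines. The
  same works for two rulings with intersection number \<open>1\<close>.
\<close>

lemma skew_lines_isometry: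
  assumes "l \<in> lines s" "l' \<in> lines s" "l \<bullet>\<^sub>P l' = 0"
  shows "\<exists>\<phi>. pic_isometry s \<phi> \<and> \<phi> l = l'"
proof (intro exI conjI)
  show "pic_isometry s (reflection (l - l'))"
    using linesD[OF assms(1)] linesD[OF assms(2)] assms(3)
    by (intro pic_isometry_reflection) (auto simp: Pic_intros inter_bilinear inter_commute[of l' l])
  show "reflection (l - l') l = l'"
    using linesD[OF assms(1)] assms(3) by (simp add: reflection_def inter_bilinear vec_eq_iff)
qed

lemma rulings_isometry_unit:
  assumes "f \<in> rulings s" "g \<in> rulings s" "f \<bullet>\<^sub>P g = 1"
  shows "\<exists>\<phi>. pic_isometry s \<phi> \<and> \<phi> f = g"
proof (intro exI conjI)
  show "pic_isometry s (reflection (f - g))"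
    using rulingsD[OF assms(1)] rulingsD[OF assms(2)] assms(3)
    by (intro pic_isometry_reflection) (auto simp: Pic_intros inter_bilinear inter_commute[of g f])
  show "reflection (f - g) f = g"
    using rulingsD[OF assms(1)] assms(3) by (simp add: reflection_def inter_bilinear vec_eq_iff)
qed

lemma obtain_three_largest:
  fixes m :: "'b \<Rightarrow> int"
  assumes "finite A" "card A \<ge> 3"
  obtains i j k where "{i, j, k} \<subseteq> A" "i \<noteq> j" "i \<noteq> k" "j \<noteq> k" "m j \<le> m i" "m k \<le> m j"
    "\<And>x. x \<in> A - {i, j} \<Longrightarrow> m x \<le> m k"
proof -
  have mx: "\<exists>i\<in>B. \<forall>x\<in>B. m x \<le> m i" if "card B > 0" for B
  proof -
    have "finite (m ` B)" "m ` B \<noteq> {}"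
      using that by (auto simp: card_gt_0_iff)
    then have "Max (m ` B) \<in> m ` B"
      by (rule Max_in)
    then obtain i where "Max (m ` B) = m i" "i \<in> B"
      by (elim imageE)
    then show ?thesis
      using Max_ge[OF \<open>finite (m ` B)\<close>] by (intro bexI[of _ i]) auto
  qed
  obtain i where i: "i \<in> A" "\<forall>x\<in>A. m x \<le> m i"
    using mx[of A] assms(2) by auto
  have card2: "card (A - {i}) \<ge> 2"
    using i assms by simp
  then obtain j where j: "j \<in> A - {i}" "\<forall>x\<in>A - {i}. m x \<le> m j"
    using mx[of "A - {i}"] by fastforce
  have "card (A - {i} - {j}) > 0"
    using j card2 assms(1) by (subst card_Diff_singleton) auto
  then obtain k where k: "k \<in> A - {i} - {j}" "\<forall>x\<in>A - {i} - {j}. m x \<le> m k"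
    using mx[of "A - {i} - {j}"] by blast
  show thesis
    by (rule that[of i j k]) (use i j k in auto)
qed

text \<open>
  For a class of degree \<open>d\<close> with nonnegative multiplicities \<open>m\<close> and square \<open>-a\<close>, either the three largest
  multiplicities add up to more than \<open>d\<close> and a Cremona reflection lowers the degree, or the class
  has square \<open>0\<close> and meets the pencil \<open>h - e\<^sub>i\<close> trivially. The proof compares two evaluations of
  \<open>\<Sum> m\<^sub>x (m\<^sub>x - m\<^sub>k)\<close>, where \<open>m\<^sub>k\<close> is the third largest multiplicity: only the two largest terms
  can be positive.
\<close>

lemma noether_inequality:
  fixes m :: "'b \<Rightarrow> int" and d a c :: int
  assumes A: "finite A" "card A \<ge> 3" and m: "\<And>x. x \<in> A \<Longrightarrow> m x \<ge> 0" and d: "d > 0"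
    and ac: "a \<ge> 0" "c > 0"
    and sq: "(\<Sum>x\<in>A. (m x)\<^sup>2) = d\<^sup>2 + a" and lin: "(\<Sum>x\<in>A. m x) = 3 * d - c"
  obtains i j k where "{i, j, k} \<subseteq> A" "i \<noteq> j" "i \<noteq> k" "j \<noteq> k" "m i + m j + m k > d"
    | i where "i \<in> A" "m i = d" "a = 0"
proof -
  obtain i j k where ijk: "{i, j, k} \<subseteq> A" "i \<noteq> j" "i \<noteq> k" "j \<noteq> k" "m j \<le> m i" "m k \<le> m j"
    and k: "\<And>x. x \<in> A - {i, j} \<Longrightarrow> m x \<le> m k"
    using obtain_three_largest[OF A, of m] by metis
  show thesis
  proof (cases "m i + m j + m k > d")
    case True
    then show ?thesis using that(1) ijk by blast
  next
    case False
    have "(\<Sum>x\<in>A. m x * (m x - m k)) = (\<Sum>x\<in>A. (m x)\<^sup>2) - m k * (\<Sum>x\<in>A. m x)"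
      by (simp add: sum_distrib_left sum_subtractf algebra_simps power2_eq_square)
    also have "\<dots> = d * (d - 3 * m k) + a + c * m k"
      unfolding sq lin by (simp add: algebra_simps power2_eq_square)
    finally have eq: "(\<Sum>x\<in>A. m x * (m x - m k)) = d * (d - 3 * m k) + a + c * m k" .
    \<comment> \<open>Terms other than those of \<open>i\<close> and \<open>j\<close> are nonpositive, and \<open>m j\<close> is replaced by \<open>m i\<close>.\<close>
    have "(\<Sum>x\<in>A. m x * (m x - m k)) 
        = (\<Sum>x\<in>{i, j}. m x * (m x - m k)) + (\<Sum>x\<in>A - {i, j}. m x * (m x - m k))"
      using ijk A by (subst sum.subset_diff[of "{i, j}" A]) auto
    also have "(\<Sum>x\<in>A - {i, j}. m x * (m x - m k)) \<le> 0"
      using k m by (intro sum_nonpos mult_nonneg_nonpos) auto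
    also have "(\<Sum>x\<in>{i, j}. m x * (m x - m k)) = m i * (m i - m k) + m j * (m j - m k)"
      using ijk by simp
    also have "m j * (m j - m k) \<le> m i * (m j - m k)"
      using ijk by (intro mult_right_mono) auto
    also have "m i * (m i - m k) + m i * (m j - m k) = m i * (m i + m j - 2 * m k)"
      by (simp add: algebra_simps)
    also have "\<dots> \<le> m i * (d - 3 * m k)"
      using False m ijk by (intro mult_left_mono) auto
    finally have "d * (d - 3 * m k) + a + c * m k \<le> m i * (d - 3 * m k)"
      using eq by simp
    then have le: "(d - m i) * (d - 3 * m k) + a + c * m k \<le> 0"
      by (simp add: algebra_simps)
    have nn: "m i \<ge> 0" "m j \<ge> 0" "m k \<ge> 0"
      using m ijk by auto
    have "(d - m i) * (d - 3 * m k) \<ge> 0"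
      using False nn ijk by (intro mult_nonneg_nonneg) linarith+
    moreover have "c * m k \<ge> 0"
      using ac nn by simp
    ultimately have "a = 0" "c * m k = 0" "(d - m i) * (d - 3 * m k) = 0"
      using le ac by linarith+
    then have "a = 0" "m i = d"
      using ac d by auto
    then show ?thesis
      using that(2) ijk by blast
  qed
qed

lemma cremona_isometry:
  assumes "{i, j, k} \<subseteq> {1..s}" "i \<noteq> j" "i \<noteq> k" "j \<noteq> k" "s \<le> 8"
  shows "pic_isometry s (reflection (hyp - exc i - exc j - exc k))"
    and "reflection (hyp - exc i - exc j - exc k) D \<bullet>\<^sub>P hyp 
      = 2 * (D \<bullet>\<^sub>P hyp) - (D \<bullet>\<^sub>P exc i + D \<bullet>\<^sub>P exc j + D \<bullet>\<^sub>P exc k)"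
  using assms
  by (auto intro!: pic_isometry_reflection simp: reflection_def Pic_intros inter_bilinear
      inter_exc_exc exc_canon inter_exc_hyp inter_hyp_exc inter_hyp_hyp hyp_canon)

lemma Pic_squares:
  assumes "D \<in> Pic s" "s \<le> 8"
  shows "(\<Sum>i=1..s. (D \<bullet>\<^sub>P exc i)\<^sup>2) = (D \<bullet>\<^sub>P hyp)\<^sup>2 - D \<bullet>\<^sub>P D"
  using inter_expand[OF assms, of D] by (simp add: power2_eq_square)

text \<open>
  Induction on the degree. Once no multiplicity is negative, i.e. the line is none of the \<open>e\<^sub>i\<close>,
  Noether's inequality applies; its second alternative is impossible because a line has square
  \<open>-1\<close>.
\<close>

lemma line_isometric_exc:
  assumes s: "3 \<le> s" "s \<le> 8" and "l \<in> lines s"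
  shows "\<exists>\<phi>. pic_isometry s \<phi> \<and> \<phi> l = exc s"
  using assms(3)
proof (induction "nat (l \<bullet>\<^sub>P hyp)" arbitrary: l rule: less_induct)
  case less
  note l = linesD[OF less.prems]
  show ?case
  proof (cases "\<exists>i\<in>{1..s}. l = exc i")
    case True
    then obtain i where i: "i \<in> {1..s}" "l = exc i" by blast
    show ?thesis
    proof (cases "i = s")
      case True
      then show ?thesis using i pic_isometry_id by blast
    next
      case False
      then show ?thesis
        using i s by (intro skew_lines_isometry) (auto simp: exc_line inter_exc_exc)
    qed
  next
    case False
    define m where "m i = l \<bullet>\<^sub>P exc i" for i
    have m: "m i \<ge> 0" if "i \<in> {1..s}" for i
      unfolding m_def using line_line_nonneg[OF s(2) less.prems] False that s exc_line by blast
    have lin: "(\<Sum>i=1..s. m i) = 3 * (l \<bullet>\<^sub>P hyp) - 1"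
      using l(3) by (simp add: inter_canon m_def)
    moreover have "(\<Sum>i=1..s. m i) \<ge> 0"
      using m by (intro sum_nonneg) auto
    ultimately have d: "l \<bullet>\<^sub>P hyp > 0"
      by linarith
    have sq: "(\<Sum>i=1..s. (m i)\<^sup>2) = (l \<bullet>\<^sub>P hyp)\<^sup>2 + 1"
      using Pic_squares[OF l(1) s(2)] l(2) by (simp add: m_def)
    obtain i j k where ijk: "{i, j, k} \<subseteq> {1..s}" "i \<noteq> j" "i \<noteq> k" "j \<noteq> k"
      and gt: "m i + m j + m k > l \<bullet>\<^sub>P hyp"
      by (rule noether_inequality[OF _ _ m d _ _ sq lin]) (use s in auto)
    define \<rho> where "\<rho> = reflection (hyp - exc i - exc j - exc k)"
    have \<rho>: "pic_isometry s \<rho>" and deg: "\<rho> l \<bullet>\<^sub>P hyp < l \<bullet>\<^sub>P hyp"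
      using cremona_isometry[OF ijk s(2)] gt by (auto simp: \<rho>_def m_def)
    obtain \<phi> where "pic_isometry s \<phi>" "\<phi> (\<rho> l) = exc s"
      using less.hyps[of "\<rho> l"] lines_isometry[OF \<rho> less.prems] deg d by auto
    then show ?thesis
      using pic_isometry_comp[OF \<rho>] by blast
  qed
qed

text \<open>
  Here both alternatives of Noether's inequality occur; the second one means that the ruling is
  orthogonal to the ruling \<open>h - e\<^sub>i\<close> and so equal to it.
\<close>

lemma ruling_isometric_hyp_diff_exc:
  assumes s: "3 \<le> s" "s \<le> 8" and "f \<in> rulings s"
  shows "\<exists>\<phi>. pic_isometry s \<phi> \<and> \<phi> f = hyp - exc s"
  using assms(3)
proof (induction "nat (f \<bullet>\<^sub>P hyp)" arbitrary: f rule: less_induct)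
  case less
  note f = rulingsD[OF less.prems]
  define m where "m i = f \<bullet>\<^sub>P exc i" for i
  have m: "m i \<ge> 0" if "i \<in> {1..s}" for i
    unfolding m_def using ruling_line_nonneg[OF s(2) less.prems] that s exc_line by blast
  have lin: "(\<Sum>i=1..s. m i) = 3 * (f \<bullet>\<^sub>P hyp) - 2"
    using f(3) by (simp add: inter_canon m_def)
  moreover have "(\<Sum>i=1..s. m i) \<ge> 0"
    using m by (intro sum_nonneg) auto
  ultimately have d: "f \<bullet>\<^sub>P hyp > 0"
    by linarith
  have sq: "(\<Sum>i=1..s. (m i)\<^sup>2) = (f \<bullet>\<^sub>P hyp)\<^sup>2 + 0"
    using Pic_squares[OF f(1) s(2)] f(2) by (simp add: m_def)
  consider (reduce) i j k where "{i, j, k} \<subseteq> {1..s}" "i \<noteq> j" "i \<noteq> k" "j \<noteq> k"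
      "m i + m j + m k > f \<bullet>\<^sub>P hyp"
    | (pencil) i where "i \<in> {1..s}" "m i = f \<bullet>\<^sub>P hyp"
    by (rule noether_inequality[OF _ _ m d _ _ sq lin]) (use s in auto)
  then show ?case
  proof cases
    case reduce
    define \<rho> where "\<rho> = reflection (hyp - exc i - exc j - exc k)"
    have \<rho>: "pic_isometry s \<rho>" and deg: "\<rho> f \<bullet>\<^sub>P hyp < f \<bullet>\<^sub>P hyp"
      using cremona_isometry[OF reduce(1-4) s(2)] reduce(5) by (auto simp: \<rho>_def m_def)
    obtain \<phi> where "pic_isometry s \<phi>" "\<phi> (\<rho> f) = hyp - exc s"
      using less.hyps[of "\<rho> f"] rulings_isometry[OF \<rho> less.prems] deg d by auto
    then show ?thesis
      using pic_isometry_comp[OF \<rho>] by blast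
  next
    case pencil
    have f_eq: "f = hyp - exc i"
      using pencil s less.prems
      by (intro rulings_eqI[of s]) (auto simp: hyp_diff_exc_ruling inter_right m_def)
    show ?thesis
    proof (cases "i = s")
      case True
      then show ?thesis using f_eq pic_isometry_id by blast
    next
      case False
      then show ?thesis
        using f_eq pencil(1) s
        by (intro rulings_isometry_unit) (auto simp: hyp_diff_exc_ruling inter_bilinear
            inter_exc_exc inter_exc_hyp inter_hyp_exc inter_hyp_hyp)
    qed
  qed
qed

section \<open>Blowing down a line\<close>

text \<open>
  Blowing down \<open>e\<^sub>r\<close> identifies \<open>Pic S\<^sub>r\<^sub>-\<^sub>1\<close> with the orthogonal complement of \<open>e\<^sub>r\<close>.
\<close>

lemma Pic_pred_iff:
  assumes "1 \<le> r" "r \<le> 8"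
  shows "D \<in> Pic (r - 1) \<longleftrightarrow> D \<in> Pic r \<and> D \<bullet>\<^sub>P exc r = 0"
proof
  assume D: "D \<in> Pic (r - 1)"
  have "(\<Sum>i=1..r - 1. (exc r \<bullet>\<^sub>P exc i) * (D \<bullet>\<^sub>P exc i)) = 0"
    using assms by (intro sum.neutral) (auto simp: inter_exc_exc)
  then have "exc r \<bullet>\<^sub>P D = 0"
    using assms inter_expand[OF D, of "exc r"] by (simp add: inter_exc_hyp)
  moreover have "D \<in> Pic r"
    using assms by (subst Pic_expand[OF D])
      (auto intro!: Pic_diff Pic_scale Pic_sum hyp_in_Pic exc_in_Pic)
  ultimately show "D \<in> Pic r \<and> D \<bullet>\<^sub>P exc r = 0"
    by (simp add: inter_commute)
next
  assume D: "D \<in> Pic r \<and> D \<bullet>\<^sub>P exc r = 0"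
  have "{1..r} = insert r {1..r - 1}"
    using assms by auto
  then have "(\<Sum>i=1..r. (D \<bullet>\<^sub>P exc i) *s exc i) = (\<Sum>i=1..r - 1. (D \<bullet>\<^sub>P exc i) *s exc i)"
    using D assms by simp
  then have "D = (D \<bullet>\<^sub>P hyp) *s hyp - (\<Sum>i=1..r - 1. (D \<bullet>\<^sub>P exc i) *s exc i)"
    using Pic_expand[of D r] D assms by simp
  moreover have "\<dots> \<in> Pic (r - 1)"
    by (intro Pic_diff Pic_scale Pic_sum hyp_in_Pic exc_in_Pic)
  ultimately show "D \<in> Pic (r - 1)"
    by simp
qed

lemma inter_canon_pred:
  assumes "1 \<le> r"
  shows "D \<bullet>\<^sub>P canon r = D \<bullet>\<^sub>P canon (r - 1) + D \<bullet>\<^sub>P exc r"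
proof -
  have "{1..r} = insert r {1..r - 1}"
    using assms by auto
  then show ?thesis
    using assms by (simp add: inter_canon)
qed

lemma lines_pred: 
  assumes "1 \<le> r" "r \<le> 8"
  shows "lines (r - 1) = {D \<in> Pic r. D \<bullet>\<^sub>P D = -1 \<and> D \<bullet>\<^sub>P canon r = -1 \<and> D \<bullet>\<^sub>P exc r = 0}"
  unfolding lines_def Pic_pred_iff[OF assms] inter_canon_pred[OF assms(1)] by auto

lemma rulings_pred: 
  assumes "1 \<le> r" "r \<le> 8"
  shows "rulings (r - 1) = {D \<in> Pic r. D \<bullet>\<^sub>P D = 0 \<and> D \<bullet>\<^sub>P canon r = -2 \<and> D \<bullet>\<^sub>P exc r = 0}"
  unfolding set_eq_iff rulings_iff Pic_pred_iff[OF assms] inter_canon_pred[OF assms(1)] by auto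

lemma skew_lines_eqpoll_lines_pred:
  assumes r: "4 \<le> r" "r \<le> 8" and l: "l \<in> lines r"
  shows "N 0 l r \<approx> lines (r - 1)"
proof -
  obtain \<phi> where \<phi>: "pic_isometry r \<phi>" "\<phi> l = exc r"
    using line_isometric_exc[of r l] assms by auto
  have "N 0 l r = {D \<in> Pic r. D \<bullet>\<^sub>P D = -1 \<and> D \<bullet>\<^sub>P canon r = -1 \<and> D \<bullet>\<^sub>P l = 0}"
    by (auto simp: N_def lines_def)
  then show ?thesis
    using bij_betw_pic_isometry[OF \<phi>(1) linesD(1)[OF l], of "\<lambda>a b c. a = -1 \<and> b = -1 \<and> c = 0"]
      r lines_pred[of r] \<phi>(2) unfolding eqpoll_def by auto
qed

lemma rulings_through_eqpoll_rulings_pred: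
  assumes r: "4 \<le> r" "r \<le> 8" and l: "l \<in> lines r"
  shows "{f \<in> rulings r. ruling_contains r f l} \<approx> rulings (r - 1)"
proof -
  obtain \<phi> where \<phi>: "pic_isometry r \<phi>" "\<phi> l = exc r"
    using line_isometric_exc[of r l] assms by auto
  have "{f \<in> rulings r. ruling_contains r f l}
      = {D \<in> Pic r. D \<bullet>\<^sub>P D = 0 \<and> D \<bullet>\<^sub>P canon r = -2 \<and> D \<bullet>\<^sub>P l = 0}"
    using l by (auto simp: ruling_contains_iff rulings_iff)
  then show ?thesis
    using bij_betw_pic_isometry[OF \<phi>(1) linesD(1)[OF l], of "\<lambda>a b c. a = 0 \<and> b = -2 \<and> c = 0"]
      r rulings_pred[of r] \<phi>(2) unfolding eqpoll_def by auto
qed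

text \<open>
  A line that meets \<open>l\<close> once completes it to a reducible fibre of a conic fibration.
\<close>

lemma meeting_lines_eqpoll_rulings:
  assumes l: "l \<in> lines r"
  shows "N 1 l r \<approx> {f \<in> rulings r. ruling_contains r f l}"
proof -
  have "bij_betw (\<lambda>l'. l' + l) (N 1 l r) {f \<in> rulings r. ruling_contains r f l}"
  proof (intro bij_betw_byWitness[where f' = "\<lambda>f. f - l"] subsetI)
    fix f assume "f \<in> (\<lambda>l'. l' + l) ` N 1 l r"
    then show "f \<in> {f \<in> rulings r. ruling_contains r f l}"
      using l line_add_line_ruling by (auto simp: N_def ruling_contains_def)
  next
    fix l' assume "l' \<in> (\<lambda>f. f - l) ` {f \<in> rulings r. ruling_contains r f l}"
    then obtain f where "f \<in> rulings r" "ruling_contains r f l" "l' = f - l"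
      by auto
    then show "l' \<in> N 1 l r"
      using l linesD[OF l] ruling_contains_iff[of f r l]
      by (auto simp: N_def ruling_contains_def inter_left)
  qed auto
  then show ?thesis
    unfolding eqpoll_def by blast
qed

section \<open>Lines meeting a given line with multiplicity\<close>

lemma double_anticanonical_minus_line:
  assumes "l \<in> lines 8"
  shows "- (2 *s canon 8) - l \<in> lines 8"
  using linesD[OF assms]
  by (auto simp: lines_def Pic_intros inter_bilinear canon_canon inter_commute[of "canon 8" l])

text \<open>
  For \<open>s = 8\<close> the value \<open>3\<close>, and for \<open>s = 7\<close> the value \<open>2\<close>, is the maximal intersection number of
  two lines, and the equality case of the Hodge index theorem determines their sum.
\<close>

lemma N_3_eq:
  assumes l: "l \<in> lines 8"
  shows "N 3 l 8 = {- (2 *s canon 8) - l}"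
proof -
  have "l' = - (2 *s canon 8) - l" if "l' \<in> N 3 l 8" for l'
    using line_line_eq_3(2)[of 8 l' l] that l by (auto simp: N_def algebra_simps)
  moreover have "- (2 *s canon 8) - l \<in> N 3 l 8"
    using double_anticanonical_minus_line[OF l] linesD[OF l]
    by (auto simp: N_def inter_left inter_commute[of "canon 8" l])
  ultimately show ?thesis
    by blast
qed

lemma N_2_eq:
  assumes l: "l \<in> lines 7"
  shows "N 2 l 7 = {- canon 7 - l}"
proof -
  have "l' = - canon 7 - l" if "l' \<in> N 2 l 7" for l'
  proof -
    have eq: "2 *s (l' + l) = - (2 *s canon 7)"
      using line_line_le(2)[of 7 l' l] that l by (simp add: N_def)
    have "l' $ i = - canon 7 $ i - l $ i" for i
      using arg_cong[OF eq, of "\<lambda>v. v $ i"] by simp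
    then show ?thesis
      by (simp add: vec_eq_iff)
  qed
  moreover have "- canon 7 - l \<in> N 2 l 7"
    using linesD[OF l]
    by (auto simp: N_def lines_def Pic_intros inter_bilinear canon_canon
        inter_commute[of "canon 7" l])
  ultimately show ?thesis
    by blast
qed

lemma N_2_eq_skew_lines:
  assumes l: "l \<in> lines 8"
  shows "N 2 l 8 = N 0 (- (2 *s canon 8) - l) 8"
proof -
  have "l' \<bullet>\<^sub>P (- (2 *s canon 8) - l) = 2 - l' \<bullet>\<^sub>P l" if "l' \<in> lines 8" for l'
    using linesD(3)[OF that] by (simp add: inter_right)
  then show ?thesis
    by (auto simp: N_def)
qed

lemma N_0_eq_skew:
  assumes "l \<in> lines s"
  shows "N 0 l s = {l' \<in> lines s. skew l' l}"
  using linesD(2)[OF assms] by (auto simp: N_def skew_def)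

section \<open>Supporting hyperplanes for the intersection form\<close>

lemma inter_eq_inner:
  fixes x w :: "real ^ 9"
  shows "x \<bullet>\<^sub>P w = (\<chi> i. if i = 0 then w $ i else - w $ i) \<bullet> x"
proof -
  have "(\<Sum>i\<in>UNIV - {0}. (if i = 0 then w $ i else - w $ i) * x $ i) 
      = - (\<Sum>i\<in>UNIV - {0}. x $ i * w $ i)"
    unfolding sum_negf[symmetric] by (intro sum.cong) auto
  then show ?thesis
    by (simp add: inter_def inner_vec_def sum.remove[of UNIV "0 :: 9"] mult.commute)
qed

lemma convex_inter_ge: "convex {x :: real ^ 9. x \<bullet>\<^sub>P w \<ge> b}"
  unfolding inter_eq_inner by (rule convex_halfspace_ge)

lemma convex_inter_eq: "convex {x :: real ^ 9. x \<bullet>\<^sub>P w = b}"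
  unfolding inter_eq_inner by (rule convex_hyperplane)

text \<open>
  The points strictly on the positive side, together with the hull of the points of \<open>S\<close> on the
  hyperplane, form a convex set, because a proper combination lies on the hyperplane only if both
  end points do. This set contains \<open>S\<close>.
\<close>

lemma convex_hull_Int_supporting:
  fixes S :: "(real ^ 9) set"
  assumes S: "\<And>x. x \<in> S \<Longrightarrow> x \<bullet>\<^sub>P w \<ge> b"
  shows "convex hull S \<inter> {x. x \<bullet>\<^sub>P w = b} = convex hull (S \<inter> {x. x \<bullet>\<^sub>P w = b})"
    (is "_ \<inter> ?H = ?F")
proof
  have F: "?F \<subseteq> ?H"
    by (intro hull_minimal convex_inter_eq) auto
  then show "?F \<subseteq> convex hull S \<inter> ?H"
    using hull_mono[of "S \<inter> ?H" S convex] by auto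
  define C where "C = {x. x \<bullet>\<^sub>P w > b} \<union> ?F"
  have "convex C"
  proof (rule convexI)
    fix x y :: "real ^ 9" and u v :: real
    assume xy: "x \<in> C" "y \<in> C" and uv: "0 \<le> u" "0 \<le> v" "u + v = 1"
    have ge: "x \<bullet>\<^sub>P w - b \<ge> 0" "y \<bullet>\<^sub>P w - b \<ge> 0"
      using xy F by (auto simp: C_def)
    have comb: "(u *\<^sub>R x + v *\<^sub>R y) \<bullet>\<^sub>P w - b = u * (x \<bullet>\<^sub>P w - b) + v * (y \<bullet>\<^sub>P w - b)"
    proof -
      have "b = u * b + v * b"
        using uv by (metis distrib_right mult_1)
      then show ?thesis
        by (simp add: inter_left algebra_simps)
    qed
    show "u *\<^sub>R x + v *\<^sub>R y \<in> C"
    proof (cases "u = 0 \<or> v = 0")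
      case True
      then show ?thesis using xy uv by auto
    next
      case False
      then have uv0: "u > 0" "v > 0" using uv by auto
      show ?thesis
      proof (cases "x \<bullet>\<^sub>P w = b \<and> y \<bullet>\<^sub>P w = b")
        case True
        then have "x \<in> ?F" "y \<in> ?F" using xy by (auto simp: C_def)
        then have "u *\<^sub>R x + v *\<^sub>R y \<in> ?F"
          using uv by (intro convexD[OF convex_convex_hull])
        then show ?thesis by (simp add: C_def)
      next
        case False
        then have "u * (x \<bullet>\<^sub>P w - b) > 0 \<or> v * (y \<bullet>\<^sub>P w - b) > 0"
          using ge uv0 by (auto simp: zero_less_mult_iff)
        moreover have "u * (x \<bullet>\<^sub>P w - b) \<ge> 0" "v * (y \<bullet>\<^sub>P w - b) \<ge> 0"
          using ge uv by simp_all
        ultimately have "u * (x \<bullet>\<^sub>P w - b) + v * (y \<bullet>\<^sub>P w - b) > 0"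
          by linarith
        then show ?thesis using comb by (simp add: C_def)
      qed
    qed
  qed
  moreover have "S \<subseteq> C"
    using S hull_subset[of "S \<inter> ?H" convex] by (force simp: C_def order_less_le)
  ultimately have "convex hull S \<subseteq> C"
    by (intro hull_minimal)
  then show "convex hull S \<inter> ?H \<subseteq> ?F"
    by (auto simp: C_def)
qed

lemma face_of_convex_hull_supporting:
  fixes S :: "(real ^ 9) set"
  assumes S: "\<And>x. x \<in> S \<Longrightarrow> x \<bullet>\<^sub>P w \<ge> b"
  shows "convex hull (S \<inter> {x. x \<bullet>\<^sub>P w = b}) face_of convex hull S"
proof -
  have "convex hull S \<subseteq> {x. x \<bullet>\<^sub>P w \<ge> b}"
    using S by (intro hull_minimal convex_inter_ge) auto
  then have "convex hull S \<inter> {x. x \<bullet>\<^sub>P w = b} face_of convex hull S"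
    unfolding inter_eq_inner
    by (intro face_of_Int_supporting_hyperplane_ge convex_convex_hull) auto
  then show ?thesis
    using convex_hull_Int_supporting[OF S] by simp
qed

lemma extreme_point_of_convex_hull_strict:
  fixes S :: "(real ^ 9) set"
  assumes "a \<in> S" "\<And>x. x \<in> S \<Longrightarrow> x \<noteq> a \<Longrightarrow> x \<bullet>\<^sub>P w > a \<bullet>\<^sub>P w"
  shows "a extreme_point_of convex hull S"
proof -
  have "S \<inter> {x. x \<bullet>\<^sub>P w = a \<bullet>\<^sub>P w} = {a}"
    using assms by force
  moreover have "x \<bullet>\<^sub>P w \<ge> a \<bullet>\<^sub>P w" if "x \<in> S" for x
    using assms that by (cases "x = a") (auto intro: less_imp_le)
  ultimately show ?thesis
    using face_of_convex_hull_supporting[of S "a \<bullet>\<^sub>P w" w] by (simp add: face_of_singleton)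
qed

section \<open>Vertices of the Gosset polytopes\<close>

lemma vertex_add: "vertex (C + D) = vertex C + vertex D"
  and vertex_diff: "vertex (C - D) = vertex C - vertex D"
  and vertex_minus: "vertex (- D) = - vertex D"
  and vertex_scale: "vertex (a *s D) = of_int a *\<^sub>R vertex D"
  and vertex_zero: "vertex 0 = 0"
  by (simp_all add: vertex_def vec_eq_iff)

lemma vertex_sum: "vertex (\<Sum>i\<in>A. C i) = (\<Sum>i\<in>A. vertex (C i))"
  by (induction A rule: infinite_finite_induct) (simp_all add: vertex_add vertex_zero)

lemma inter_vertex: "vertex C \<bullet>\<^sub>P vertex D = of_int (C \<bullet>\<^sub>P D)"
  by (simp add: inter_def vertex_def)

lemma vertex_eq_iff: "vertex C = vertex D \<longleftrightarrow> C = D"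
  by (simp add: vertex_def vec_eq_iff)

lemma vertex_in_gosset: "l \<in> lines s \<Longrightarrow> vertex l \<in> gosset s"
  unfolding gosset_def by (intro hull_inc) auto

text \<open>
  The functional given by \<open>l\<close> takes the value \<open>-1\<close> at \<open>l\<close> and is nonnegative at every other line,
  so \<open>l\<close> is an exposed vertex.
\<close>

lemma extreme_points_gosset:
  assumes "s \<le> 8"
  shows "{x. x extreme_point_of gosset s} = vertex ` lines s"
proof (intro set_eqI iffI)
  fix x assume "x \<in> {x. x extreme_point_of gosset s}"
  then show "x \<in> vertex ` lines s"
    unfolding gosset_def by (auto dest: extreme_point_of_convex_hull)
next
  fix x assume "x \<in> vertex ` lines s"
  then obtain l where l: "l \<in> lines s" "x = vertex l" by auto
  have "vertex l' \<bullet>\<^sub>P vertex l > vertex l \<bullet>\<^sub>P vertex l" if "l' \<in> lines s" "l' \<noteq> l" for l'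
    using line_line_nonneg[OF assms that(1) l(1) that(2)] linesD(2)[OF l(1)]
    by (simp add: inter_vertex)
  then show "x \<in> {x. x extreme_point_of gosset s}"
    unfolding gosset_def mem_Collect_eq l(2) using l(1)
    by (intro extreme_point_of_convex_hull_strict[of _ _ "vertex l"]) auto
qed

lemma lines_eqpoll_extreme_points:
  assumes "s \<le> 8"
  shows "lines s \<approx> {x. x extreme_point_of gosset s}"
  unfolding extreme_points_gosset[OF assms]
  by (intro eqpoll_sym[OF inj_on_image_eqpoll_self]) (simp add: inj_on_def vertex_eq_iff)

text \<open>
  The equation \<open>3d = 1 + \<Sum> m\<^sub>i\<close> for a line allows one to eliminate \<open>d\<close>: the line is \<open>h / 3\<close> plus a
  combination of the \<open>s\<close> vectors \<open>h / 3 - e\<^sub>i\<close>.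
\<close>

lemma aff_dim_gosset_le:
  assumes "s \<le> 8"
  shows "aff_dim (gosset s) \<le> int s"
proof -
  define p where "p = (1/3) *\<^sub>R vertex hyp"
  define u where "u i = p - vertex (exc i)" for i
  have "vertex l \<in> (+) p ` span (u ` {1..s})" if l: "l \<in> lines s" for l
  proof -
    define m where "m i = real_of_int (l \<bullet>\<^sub>P exc i)" for i
    have "real_of_int (\<Sum>i=1..s. l \<bullet>\<^sub>P exc i) = real_of_int (3 * (l \<bullet>\<^sub>P hyp) - 1)"
      using linesD(3)[OF l] by (subst of_int_eq_iff) (simp add: inter_canon)
    then have "real_of_int (l \<bullet>\<^sub>P hyp) = (1 + (\<Sum>i=1..s. m i)) / 3"
      by (simp add: m_def)
    then have "real_of_int (l \<bullet>\<^sub>P hyp) *\<^sub>R vertex hyp = p + (\<Sum>i=1..s. m i) *\<^sub>R p"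
      by (simp add: p_def scaleR_left_distrib[symmetric] add_divide_distrib)
    then have "vertex l = p + (\<Sum>i=1..s. m i) *\<^sub>R p - (\<Sum>i=1..s. m i *\<^sub>R vertex (exc i))"
      by (subst Pic_expand[OF linesD(1)[OF l] assms])
        (simp add: vertex_diff vertex_scale vertex_sum m_def)
    also have "\<dots> = p + (\<Sum>i=1..s. m i *\<^sub>R u i)"
      by (simp add: u_def scaleR_right_diff_distrib sum_subtractf scaleR_left.sum)
    moreover have "(\<Sum>i=1..s. m i *\<^sub>R u i) \<in> span (u ` {1..s})"
      by (intro span_sum span_scale span_base imageI)
    ultimately show ?thesis
      by simp
  qed
  then have "gosset s \<subseteq> (+) p ` span (u ` {1..s})"
    unfolding gosset_def
    by (intro hull_minimal convex_translation subspace_imp_convex subspace_span) auto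
  then have "aff_dim (gosset s) \<le> aff_dim ((+) p ` span (u ` {1..s}))"
    by (rule aff_dim_subset)
  also have "\<dots> = int (dim (u ` {1..s}))"
    by (simp add: aff_dim_translation_eq aff_dim_subspace)
  also have "\<dots> \<le> int s"
    using dim_le_card'[of "u ` {1..s}"] card_image_le[of "{1..s}" u] by simp
  finally show ?thesis .
qed

section \<open>The facet of a ruling\<close>

definition ruling_face :: "nat \<Rightarrow> int ^ 9 \<Rightarrow> (real ^ 9) set"
  where "ruling_face s f = convex hull (vertex ` {l \<in> lines s. l \<bullet>\<^sub>P f = 0})"

lemma
  assumes s: "s \<le> 8" and f: "f \<in> rulings s"
  shows ruling_face_eq: "ruling_face s f = gosset s \<inter> {x. x \<bullet>\<^sub>P vertex f = 0}"
    and ruling_face_face: "ruling_face s f face_of gosset s"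
proof -
  have S: "vertex ` {l \<in> lines s. l \<bullet>\<^sub>P f = 0} = vertex ` lines s \<inter> {x. x \<bullet>\<^sub>P vertex f = 0}"
    by (auto simp: inter_vertex)
  have ge: "x \<bullet>\<^sub>P vertex f \<ge> 0" if "x \<in> vertex ` lines s" for x
    using ruling_line_nonneg[OF s f] that by (auto simp: inter_vertex inter_commute[of _ f])
  show "ruling_face s f = gosset s \<inter> {x. x \<bullet>\<^sub>P vertex f = 0}"
    unfolding ruling_face_def gosset_def S by (rule convex_hull_Int_supporting[symmetric, OF ge])
  show "ruling_face s f face_of gosset s"
    unfolding ruling_face_def gosset_def S by (rule face_of_convex_hull_supporting[OF ge])
qed

lemma vertex_in_ruling_face_iff:
  assumes "s \<le> 8" "f \<in> rulings s" "l \<in> lines s"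
  shows "vertex l \<in> ruling_face s f \<longleftrightarrow> l \<bullet>\<^sub>P f = 0"
  using vertex_in_gosset[OF assms(3)] by (simp add: ruling_face_eq[OF assms(1,2)] inter_vertex)

text \<open>
  A line with \<open>d = m\<^sub>s\<close> has exactly one further nonzero multiplicity, and this is \<open>1\<close> or \<open>-1\<close>. The
  lines in fibres of the pencil \<open>h - e\<^sub>s\<close> are thus the \<open>e\<^sub>i\<close> and their complements
  \<open>h - e\<^sub>s - e\<^sub>i\<close>; the index is shifted to start at \<open>0\<close>.
\<close>

lemma lines_in_pencil:
  assumes s: "3 \<le> s" "s \<le> 8" and l: "l \<in> lines s" "l \<bullet>\<^sub>P (hyp - exc s) = 0"
  shows "\<exists>i<s - 1. l = exc (Suc i) \<or> l \<bullet>\<^sub>P exc (Suc i) = 1"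
proof -
  define m where "m i = l \<bullet>\<^sub>P exc i" for i
  have "{1..s} = insert s {1..s - 1}" "s \<notin> {1..s - 1}"
    using s by auto
  then have "(\<Sum>i=1..s. (m i)\<^sup>2) = (m s)\<^sup>2 + (\<Sum>i=1..s - 1. (m i)\<^sup>2)"
    by simp
  moreover have "m s = l \<bullet>\<^sub>P hyp"
    using l(2) by (simp add: m_def inter_right)
  ultimately have sum1: "(\<Sum>i=1..s - 1. (m i)\<^sup>2) = 1"
    using Pic_squares[OF linesD(1)[OF l(1)] s(2)] linesD(2)[OF l(1)] by (simp add: m_def)
  then obtain i where i: "i \<in> {1..s - 1}" "m i \<noteq> 0"
    by (metis (no_types, lifting) sum.neutral zero_neq_one zero_power2)
  have "(m i)\<^sup>2 \<le> (\<Sum>i=1..s - 1. (m i)\<^sup>2)"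
    using i by (intro member_le_sum) auto
  then have "\<bar>m i\<bar> \<le> 1"
    using sum1 abs_le_square_iff[of "m i" 1] by simp
  then have "m i = 1 \<or> m i = -1"
    using i(2) by linarith
  then have "l = exc i \<or> l \<bullet>\<^sub>P exc i = 1"
    using line_line_ge(2)[OF s(2) l(1) exc_line] i(1) s by (auto simp: m_def)
  then show ?thesis
    using i(1) by (intro exI[of _ "i - 1"]) auto
qed

text \<open>
  The \<open>s - 1\<close> reducible fibres of a ruling: by transitivity it suffices to know those of the pencil
  \<open>h - e\<^sub>s\<close>. A line \<open>l\<close> orthogonal to \<open>f\<close> with \<open>l \<sqdot> L\<^sub>i = 1\<close> satisfies \<open>l \<sqdot> (f - L\<^sub>i) = -1\<close>, and
  lines with intersection number \<open>-1\<close> coincide.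
\<close>

lemma ruling_axes:
  assumes s: "3 \<le> s" "s \<le> 8" and f: "f \<in> rulings s"
  obtains L where "\<And>i. i < s - 1 \<Longrightarrow> L i \<in> lines s \<and> L i \<bullet>\<^sub>P f = 0"
    "\<And>i j. i < s - 1 \<Longrightarrow> j < s - 1 \<Longrightarrow> i \<noteq> j \<Longrightarrow> L i \<bullet>\<^sub>P L j = 0"
    "{l \<in> lines s. l \<bullet>\<^sub>P f = 0} = L ` {..<s - 1} \<union> (\<lambda>i. f - L i) ` {..<s - 1}"
proof -
  obtain \<phi> where \<phi>: "pic_isometry s \<phi>" "\<phi> f = hyp - exc s"
    using ruling_isometric_hyp_diff_exc[OF s f] by blast
  have iso: "\<phi> C \<bullet>\<^sub>P \<phi> D = C \<bullet>\<^sub>P D" if "C \<in> Pic s" "D \<in> Pic s" for C D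
    using \<phi>(1) that by (simp add: pic_isometry_def)
  have bij: "bij_betw \<phi> {D \<in> Pic s. D \<bullet>\<^sub>P D = -1 \<and> D \<bullet>\<^sub>P canon s = -1 \<and> D \<bullet>\<^sub>P f = 0}
      {D \<in> Pic s. D \<bullet>\<^sub>P D = -1 \<and> D \<bullet>\<^sub>P canon s = -1 \<and> D \<bullet>\<^sub>P \<phi> f = 0}"
    using bij_betw_pic_isometry[OF \<phi>(1) rulingsD(1)[OF f],
        of "\<lambda>a b c. a = -1 \<and> b = -1 \<and> c = 0"] .
  have "\<exists>l. l \<in> lines s \<and> l \<bullet>\<^sub>P f = 0 \<and> \<phi> l = exc (Suc i)" if "i < s - 1" for i
  proof -
    have "exc (Suc i) \<bullet>\<^sub>P \<phi> f = 0"
      using that s by (simp add: \<phi>(2) inter_right inter_exc_exc inter_exc_hyp)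
    then have "exc (Suc i) \<in> \<phi> ` {D \<in> Pic s. D \<bullet>\<^sub>P D = -1 \<and> D \<bullet>\<^sub>P canon s = -1 \<and> D \<bullet>\<^sub>P f = 0}"
      using that s linesD[OF exc_line[of "Suc i" s]] unfolding bij_betw_imp_surj_on[OF bij] by auto
    then show ?thesis
      by (auto simp: lines_def)
  qed
  then obtain L where L: "\<And>i. i < s - 1 \<Longrightarrow> L i \<in> lines s \<and> L i \<bullet>\<^sub>P f = 0 \<and> \<phi> (L i) = exc (Suc i)"
    by metis
  have skew: "L i \<bullet>\<^sub>P L j = 0" if "i < s - 1" "j < s - 1" "i \<noteq> j" for i j
    using iso[of "L i" "L j"] L[OF that(1)] L[OF that(2)] that s
    by (auto simp: linesD(1) inter_exc_exc)
  have fL: "f - L i \<in> lines s \<and> (f - L i) \<bullet>\<^sub>P f = 0" if "i < s - 1" for i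
    using L[OF that] ruling_contains_iff[OF f, of "L i"] rulingsD(2)[OF f]
    by (simp add: ruling_contains_def inter_left inter_commute[of f "L i"])
  have "l \<in> L ` {..<s - 1} \<union> (\<lambda>i. f - L i) ` {..<s - 1}" if l: "l \<in> lines s" "l \<bullet>\<^sub>P f = 0" for l
  proof -
    have "\<phi> l \<bullet>\<^sub>P (hyp - exc s) = 0"
      using iso[OF linesD(1)[OF l(1)] rulingsD(1)[OF f]] l(2) \<phi>(2) by simp
    then obtain i where i: "i < s - 1" "\<phi> l = exc (Suc i) \<or> \<phi> l \<bullet>\<^sub>P exc (Suc i) = 1"
      using lines_in_pencil[OF s lines_isometry[OF \<phi>(1) l(1)]] by blast
    note Li = L[OF i(1)]
    from i(2) show ?thesis
    proof
      assume "\<phi> l = exc (Suc i)"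
      then have "l \<bullet>\<^sub>P L i = -1"
        using iso[OF linesD(1)[OF l(1)] linesD(1), of "L i"] Li i(1) s by (simp add: inter_exc_exc)
      then have "l = L i"
        using line_line_ge(2)[OF s(2) l(1)] Li by simp
      then show ?thesis using i(1) by auto
    next
      assume "\<phi> l \<bullet>\<^sub>P exc (Suc i) = 1"
      then have "l \<bullet>\<^sub>P L i = 1"
        using iso[OF linesD(1)[OF l(1)] linesD(1), of "L i"] Li by simp
      then have "l = f - L i"
        using line_line_ge(2)[OF s(2) l(1), of "f - L i"] fL[OF i(1)] l(2) by (simp add: inter_right)
      then show ?thesis using i(1) by auto
    qed
  qed
  then have "{l \<in> lines s. l \<bullet>\<^sub>P f = 0} = L ` {..<s - 1} \<union> (\<lambda>i. f - L i) ` {..<s - 1}"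
    using L fL by auto
  then show thesis
    using that L skew by blast
qed

text \<open>
  The form takes the same values on the vectors \<open>L\<^sub>i - f / 2\<close> as on the \<open>L\<^sub>i\<close>, because \<open>f\<close> is isotropic
  and orthogonal to each \<open>L\<^sub>i\<close>.
\<close>

lemma ruling_face_crosspolytope:
  assumes s: "3 \<le> s" "s \<le> 8" and f: "f \<in> rulings s"
  shows "crosspolytope (s - 1) (ruling_face s f)"
proof -
  obtain L where L: "\<And>i. i < s - 1 \<Longrightarrow> L i \<in> lines s \<and> L i \<bullet>\<^sub>P f = 0"
    and skew: "\<And>i j. i < s - 1 \<Longrightarrow> j < s - 1 \<Longrightarrow> i \<noteq> j \<Longrightarrow> L i \<bullet>\<^sub>P L j = 0"
    and ls: "{l \<in> lines s. l \<bullet>\<^sub>P f = 0} = L ` {..<s - 1} \<union> (\<lambda>i. f - L i) ` {..<s - 1}"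
    by (rule ruling_axes[OF assms]) (rule that)
  define c where "c = (1/2) *\<^sub>R vertex f"
  define v where "v i = vertex (L i) - c" for i
  have "v i \<bullet>\<^sub>P v j = of_int (L i \<bullet>\<^sub>P L j)" if "i < s - 1" "j < s - 1" for i j
    using L[OF that(1)] L[OF that(2)] rulingsD(2)[OF f]
    by (simp add: v_def c_def inter_bilinear inter_vertex inter_commute[of f "L j"])
  moreover have "L i \<bullet>\<^sub>P L i = -1" if "i < s - 1" for i
    using L[OF that] linesD(2) by blast
  ultimately have "\<forall>i<s - 1. \<forall>j<s - 1. - (v i \<bullet>\<^sub>P v j) = (if i = j then 1 else 0)"
    using skew by auto
  moreover have "vertex f = c + c"
    by (simp add: c_def flip: scaleR_add_left)
  then have "c + v i = vertex (L i)" "c - v i = vertex (f - L i)" for i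
    by (simp_all add: v_def vertex_diff)
  then have "ruling_face s f = convex hull ((\<lambda>i. c + v i) ` {..<s - 1} \<union> (\<lambda>i. c - v i) ` {..<s - 1})"
    unfolding ruling_face_def ls by (simp add: image_Un image_image)
  ultimately show ?thesis
    unfolding crosspolytope_def by (intro exI[of _ c] exI[of _ v] exI[of _ 1]) auto
qed

lemma convex_centre:
  fixes c w :: "'b::real_vector"
  assumes "convex X" "c + w \<in> X" "c - w \<in> X"
  shows "c \<in> X"
proof -
  have "(1/2) *\<^sub>R (c + w) + (1/2) *\<^sub>R (c - w) \<in> X"
    using assms by (intro convexD) auto
  also have "(1/2) *\<^sub>R (c + w) + (1/2) *\<^sub>R (c - w) = (1/2) *\<^sub>R (c + c)"
    unfolding scaleR_add_right[symmetric] by simp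
  finally show ?thesis
    by (simp flip: scaleR_2)
qed

text \<open>
  The semi-axes are orthogonal and not isotropic, hence linearly independent.
\<close>

lemma aff_dim_crosspolytope_ge:
  assumes "crosspolytope d X" "d > 0"
  shows "int d \<le> aff_dim X"
proof -
  obtain c v \<rho> where \<rho>: "\<rho> > 0" 
    and form: "\<forall>i<d. \<forall>j<d. - (v i \<bullet>\<^sub>P v j) = (if i = j then \<rho> else 0)"
    and X: "X = convex hull ((\<lambda>i. c + v i) ` {..<d} \<union> (\<lambda>i. c - v i) ` {..<d})"
    using assms(1) unfolding crosspolytope_def by blast
  have v: "v i \<bullet>\<^sub>P v j = (if i = j then - \<rho> else 0)" if "i < d" "j < d" for i j
    using form that by (metis minus_equation_iff minus_zero)
  have inj: "inj_on v {..<d}"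
  proof (rule inj_onI, rule ccontr)
    fix i j assume "i \<in> {..<d}" "j \<in> {..<d}" "v i = v j" "i \<noteq> j"
    then show False using v[of i j] v[of i i] \<rho> by simp
  qed
  have "independent (v ` {..<d})"
  proof (rule independent_if_scalars_zero)
    fix g x assume sum0: "(\<Sum>x\<in>v ` {..<d}. g x *\<^sub>R x) = 0" and "x \<in> v ` {..<d}"
    then obtain j where j: "j < d" "x = v j" by auto
    have "0 = (\<Sum>i<d. g (v i) *\<^sub>R v i) \<bullet>\<^sub>P v j"
      using sum0 by (simp add: sum.reindex[OF inj] inter_zero_left)
    also have "\<dots> = (\<Sum>i<d. if i = j then - g (v j) * \<rho> else 0)"
      unfolding inter_sum_left
    proof (rule sum.cong)
      fix i assume "i \<in> {..<d}"
      then show "(g (v i) *\<^sub>R v i) \<bullet>\<^sub>P v j = (if i = j then - g (v j) * \<rho> else 0)"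
        using v[of i j] j by (simp add: inter_left)
    qed simp
    also have "\<dots> = - g (v j) * \<rho>"
      using j by simp
    finally show "g x = 0"
      using \<rho> j by simp
  qed simp
  then have "dim (v ` {..<d}) = d"
    by (simp add: dim_eq_card_independent card_image[OF inj])
  moreover have in_X: "c + v i \<in> X" "c - v i \<in> X" if "i < d" for i
    unfolding X using that by (auto intro!: hull_inc)
  then have "v ` {..<d} \<subseteq> (+) (- c) ` X"
    by (force simp: image_iff)
  ultimately have "d \<le> dim ((+) (- c) ` X)"
    using dim_subset by metis
  moreover have "c \<in> X"
    using in_X[OF assms(2)] by (rule convex_centre[rotated]) (simp add: X)
  then have "c \<in> affine hull X"
    by (rule hull_inc)
  ultimately show ?thesis
    by (simp add: aff_dim_eq_dim)
qed

text \<open>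
  The dimension is squeezed: the face has dimension at least \<open>s - 1\<close> as a crosspolytope, it is a
  proper face because \<open>f\<close> cannot be orthogonal to all \<open>e\<^sub>i\<close>, and the polytope has dimension at most
  \<open>s\<close>.
\<close>

lemma ruling_face_facet:
  assumes s: "3 \<le> s" "s \<le> 8" and f: "f \<in> rulings s"
  shows "ruling_face s f facet_of gosset s"
proof -
  have ge: "int (s - 1) \<le> aff_dim (ruling_face s f)"
    using ruling_face_crosspolytope[OF assms] s by (intro aff_dim_crosspolytope_ge) auto
  have "ruling_face s f \<noteq> gosset s"
  proof
    assume eq: "ruling_face s f = gosset s"
    have "f \<bullet>\<^sub>P exc i = 0" if "i \<in> {1..s}" for i
      using vertex_in_ruling_face_iff[OF s(2) f exc_line[OF that s(2)]]
        vertex_in_gosset[OF exc_line[OF that s(2)]] eq by (simp add: inter_commute)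
    then have "f \<bullet>\<^sub>P hyp = 0" "f \<bullet>\<^sub>P canon s = - 3 * (f \<bullet>\<^sub>P hyp)"
      using Pic_squares[OF rulingsD(1)[OF f] s(2)] rulingsD(2)[OF f] by (auto simp: inter_canon)
    then show False
      using rulingsD(3)[OF f] by linarith
  qed
  then have "aff_dim (ruling_face s f) < aff_dim (gosset s)"
    using ruling_face_face[OF s(2) f]
    by (intro face_of_aff_dim_lt) (auto simp: gosset_def)
  then have "aff_dim (ruling_face s f) = aff_dim (gosset s) - 1"
    using ge aff_dim_gosset_le[OF s(2)] s by linarith
  moreover have "ruling_face s f \<noteq> {}"
    using ge s by auto
  ultimately show ?thesis
    using ruling_face_face[OF s(2) f] by (simp add: facet_of_def)
qed

section \<open>Every crosspolytope facet comes from a ruling\<close>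

text \<open>
  The functional given by the semi-axis \<open>v\<^sub>i\<close> is strictly minimal at \<open>c + v\<^sub>i\<close>.
\<close>

lemma crosspolytope_vertices_extreme:
  fixes c :: "real ^ 9" and v :: "nat \<Rightarrow> real ^ 9"
  assumes \<rho>: "\<rho> > 0" and v: "\<And>i j. i < d \<Longrightarrow> j < d \<Longrightarrow> v i \<bullet>\<^sub>P v j = (if i = j then - \<rho> else 0)"
    and i: "i < d"
    and X: "X = convex hull ((\<lambda>i. c + v i) ` {..<d} \<union> (\<lambda>i. c - v i) ` {..<d})"
  shows "(c + v i) extreme_point_of X" and "(c - v i) extreme_point_of X"
proof -
  show "(c + v i) extreme_point_of X"
    unfolding X
  proof (rule extreme_point_of_convex_hull_strict[of _ _ "v i"])
    fix x assume "x \<in> (\<lambda>i. c + v i) ` {..<d} \<union> (\<lambda>i. c - v i) ` {..<d}" "x \<noteq> c + v i"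
    then show "x \<bullet>\<^sub>P v i > (c + v i) \<bullet>\<^sub>P v i"
      using v i \<rho> by (auto simp: inter_left)
  qed (use i in auto)
  show "(c - v i) extreme_point_of X"
    unfolding X
  proof (rule extreme_point_of_convex_hull_strict[of _ _ "- v i"])
    fix x assume "x \<in> (\<lambda>i. c + v i) ` {..<d} \<union> (\<lambda>i. c - v i) ` {..<d}" "x \<noteq> c - v i"
    then show "x \<bullet>\<^sub>P (- v i) > (c - v i) \<bullet>\<^sub>P (- v i)"
      using v i \<rho> by (auto simp: inter_bilinear)
  qed (use i in auto)
qed

text \<open>
  The polytope of \<open>S\<^sub>8\<close> is symmetric under \<open>l \<mapsto> -2K - l\<close>. A face through the centre \<open>-K\<close> contains an
  inner point of each segment from \<open>l\<close> to \<open>-2K - l\<close>, hence all vertices.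
\<close>

lemma anticanonical_not_in_facet:
  assumes X: "X facet_of gosset 8"
  shows "vertex (- canon 8) \<notin> X"
proof
  assume K: "vertex (- canon 8) \<in> X"
  have face: "X face_of gosset 8"
    using X by (simp add: facet_of_def)
  have "vertex l \<in> X" if l: "l \<in> lines 8" for l
  proof -
    define l' where "l' = - (2 *s canon 8) - l"
    have l': "l' \<in> lines 8"
      unfolding l'_def by (rule double_anticanonical_minus_line[OF l])
    have "l \<bullet>\<^sub>P l' = 3"
      using linesD[OF l] by (simp add: l'_def inter_right)
    then have "vertex l \<noteq> vertex l'"
      using linesD(2)[OF l] by (auto simp: vertex_eq_iff)
    then have "midpoint (vertex l) (vertex l') \<in> open_segment (vertex l) (vertex l')"
      by simp
    moreover have "midpoint (vertex l) (vertex l') = vertex (- canon 8)"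
      by (simp add: midpoint_def l'_def vertex_diff vertex_minus vertex_scale)
    ultimately show ?thesis
      using face_ofD[OF face, of "vertex (- canon 8)" "vertex l" "vertex l'"] K
        vertex_in_gosset[OF l] vertex_in_gosset[OF l'] by simp
  qed
  then have "gosset 8 \<subseteq> X"
    unfolding gosset_def using face_of_imp_convex[OF face] by (intro hull_minimal) auto
  then have "X = gosset 8"
    using face_of_imp_subset[OF face] by auto
  then show False
    using X by (simp add: facet_of_def)
qed

text \<open>
  All \<open>c \<plusminus> v\<^sub>i\<close> are lines. Their squares give \<open>c \<sqdot> v\<^sub>i = 0\<close> and \<open>c\<^sup>2 = \<rho> - 1\<close>. As
  \<open>(c + v\<^sub>0) \<sqdot> (c + v\<^sub>1) = c\<^sup>2\<close>, the number \<open>q = c\<^sup>2\<close> is an integer; here at least two semi-axes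
  are needed. Opposite vertices meet \<open>2q + 1\<close> times, so \<open>-1 < q \<le> 1\<close>. For \<open>q = 0\<close> the class
  \<open>f = 2c\<close> is a ruling, and \<open>q = 1\<close> is the case \<open>c = -K\<close> of the maximal intersection number \<open>3\<close>.
\<close>

lemma crosspolytope_facet_is_ruling_face:
  assumes s: "3 \<le> s" "s \<le> 8" and "X \<in> crosspolytope_facets s"
  shows "\<exists>f\<in>rulings s. X = ruling_face s f"
proof -
  have facet: "X facet_of gosset s" and "crosspolytope (s - 1) X"
    using assms(3) by (auto simp: crosspolytope_facets_def)
  then obtain c v \<rho> where \<rho>: "\<rho> > 0"
    and form: "\<forall>i<s - 1. \<forall>j<s - 1. - (v i \<bullet>\<^sub>P v j) = (if i = j then \<rho> else 0)"
    and X: "X = convex hull ((\<lambda>i. c + v i) ` {..<s - 1} \<union> (\<lambda>i. c - v i) ` {..<s - 1})"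
    unfolding crosspolytope_def by blast
  have v: "v i \<bullet>\<^sub>P v j = (if i = j then - \<rho> else 0)" if "i < s - 1" "j < s - 1" for i j
    using form that by (metis minus_equation_iff minus_zero)
  have face: "X face_of gosset s"
    using facet by (simp add: facet_of_def)
  have extreme: "x \<in> vertex ` lines s" if "x extreme_point_of X" for x
    using that extreme_point_of_face[OF face] extreme_points_gosset[OF s(2)] by auto
  have "\<exists>a b. a \<in> lines s \<and> b \<in> lines s \<and> vertex a = c + v i \<and> vertex b = c - v i" if "i < s - 1" for i
    using extreme[OF crosspolytope_vertices_extreme(1)[OF \<rho> v that X]]
      extreme[OF crosspolytope_vertices_extreme(2)[OF \<rho> v that X]] by (auto 4 4)
  then obtain a b where ab: "\<And>i. i < s - 1 \<Longrightarrow> a i \<in> lines s \<and> b i \<in> lines s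
      \<and> vertex (a i) = c + v i \<and> vertex (b i) = c - v i"
    by metis
  have cv: "c \<bullet>\<^sub>P v i = 0" and cc: "c \<bullet>\<^sub>P c = \<rho> - 1" if "i < s - 1" for i
  proof -
    have "(c + v i) \<bullet>\<^sub>P (c + v i) = -1" "(c - v i) \<bullet>\<^sub>P (c - v i) = -1"
      using ab[OF that] linesD(2) by (metis inter_vertex of_int_minus of_int_1)+
    then show "c \<bullet>\<^sub>P v i = 0" "c \<bullet>\<^sub>P c = \<rho> - 1"
      using v[OF that that] by (simp_all add: inter_bilinear inter_commute[of "v i" c])
  qed
  have s01: "0 < s - 1" "1 < s - 1"
    using s by auto
  define q where "q = a 0 \<bullet>\<^sub>P a 1"
  have "real_of_int q = (c + v 0) \<bullet>\<^sub>P (c + v 1)"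
    using ab[OF s01(1)] ab[OF s01(2)] by (metis inter_vertex q_def)
  then have q: "real_of_int q = c \<bullet>\<^sub>P c"
    using v[OF s01] cv[OF s01(1)] cv[OF s01(2)] by (simp add: inter_bilinear inter_commute[of "v 0" c])
  have "real_of_int (a 0 \<bullet>\<^sub>P b 0) = (c + v 0) \<bullet>\<^sub>P (c - v 0)"
    using ab[OF s01(1)] by (metis inter_vertex)
  then have "real_of_int (a 0 \<bullet>\<^sub>P b 0) = real_of_int (2 * q + 1)"
    using v[OF s01(1) s01(1)] cv[OF s01(1)] cc[OF s01(1)] q 
    by (simp add: inter_bilinear inter_commute[of "v 0" c])
  then have ab0: "a 0 \<bullet>\<^sub>P b 0 = 2 * q + 1"
    by (simp only: of_int_eq_iff)
  have a0: "a 0 \<in> lines s" and b0: "b 0 \<in> lines s"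
    using ab[OF s01(1)] by auto
  define f where "f = a 0 + b 0"
  have vf: "vertex f = 2 *\<^sub>R c"
    using ab[OF s01(1)] by (simp add: f_def vertex_add scaleR_2)
  have "real_of_int q > real_of_int (-1)"
    using q cc[OF s01(1)] \<rho> by simp
  then have "q > -1"
    by (simp only: of_int_less_iff)
  moreover have "q \<le> 1"
    using line_line_le_3[OF s(2) a0 b0] ab0 by simp
  ultimately consider "q = 0" | "q = 1"
    by linarith
  then show ?thesis
  proof cases
    assume "q = 0"
    then have f: "f \<in> rulings s"
      using line_add_line_ruling[OF a0 b0] ab0 by (simp add: f_def)
    have "(c + v i) \<bullet>\<^sub>P c = 0" "(c - v i) \<bullet>\<^sub>P c = 0" if "i < s - 1" for i
      using cv[OF that] q \<open>q = 0\<close> by (simp_all add: inter_left inter_commute[of "v i" c])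
    then have "X \<subseteq> {x. x \<bullet>\<^sub>P vertex f = 0}"
      unfolding X by (intro hull_minimal convex_inter_eq) (auto simp: vf inter_scaleR_right)
    then have sub: "X \<subseteq> ruling_face s f"
      using face_of_imp_subset[OF face] by (simp add: ruling_face_eq[OF s(2) f])
    \<comment> \<open>A facet inside another facet is all of it.\<close>
    then have "X face_of ruling_face s f"
      using face_of_subset[OF face sub] ruling_face_eq[OF s(2) f] by blast
    moreover have "aff_dim X = aff_dim (ruling_face s f)"
      using facet ruling_face_facet[OF s f] by (simp add: facet_of_def)
    ultimately have "X = ruling_face s f"
      using face_of_aff_dim_lt[of "ruling_face s f" X] by (force simp: ruling_face_def)
    then show ?thesis
      using f by blast
  next
    assume "q = 1"
    then have s8: "s = 8" and "f = - (2 *s canon s)"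
      using line_line_eq_3[OF s(2) a0 b0] ab0 by (auto simp: f_def)
    then have "2 *\<^sub>R c = 2 *\<^sub>R vertex (- canon s)"
      using vf by (simp add: vertex_minus vertex_scale)
    then have "c = vertex (- canon 8)"
      using s8 by simp
    moreover have "c \<in> X"
      unfolding X using s01 by (intro convex_centre[of _ c "v 0"]) (auto intro!: hull_inc)
    ultimately show ?thesis
      using anticanonical_not_in_facet facet s8 by simp
  qed
qed

text \<open>
  If \<open>f\<close> and \<open>g\<close> have the same face, both components of a reducible fibre of \<open>f\<close> are orthogonal to
  \<open>g\<close>, hence so is \<open>f\<close>.
\<close>

lemma bij_betw_ruling_face:
  assumes s: "3 \<le> s" "s \<le> 8"
  shows "bij_betw (ruling_face s) (rulings s) (crosspolytope_facets s)"
  unfolding bij_betw_def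
proof
  show "inj_on (ruling_face s) (rulings s)"
  proof (rule inj_onI)
    fix f g assume f: "f \<in> rulings s" and g: "g \<in> rulings s" and eq: "ruling_face s f = ruling_face s g"
    obtain L where "\<And>i. i < s - 1 \<Longrightarrow> L i \<in> lines s \<and> L i \<bullet>\<^sub>P f = 0"
      by (rule ruling_axes[OF s f]) blast
    then have L: "L 0 \<in> lines s" "L 0 \<bullet>\<^sub>P f = 0"
      using s by auto
    have L': "f - L 0 \<in> lines s" "(f - L 0) \<bullet>\<^sub>P f = 0"
      using ruling_contains_iff[OF f L(1)] L(2) rulingsD(2)[OF f]
      by (auto simp: ruling_contains_def inter_left inter_commute[of f "L 0"])
    have "l \<bullet>\<^sub>P g = 0" if "l \<in> lines s" "l \<bullet>\<^sub>P f = 0" for l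
      using that vertex_in_ruling_face_iff[OF s(2) f] vertex_in_ruling_face_iff[OF s(2) g] eq by metis
    from this[OF L] this[OF L'] have "f \<bullet>\<^sub>P g = 0"
      by (simp add: inter_left)
    then show "f = g"
      by (rule rulings_eqI[OF s(2) f g])
  qed
  show "ruling_face s ` rulings s = crosspolytope_facets s"
    using crosspolytope_facet_is_ruling_face[OF s] ruling_face_facet[OF s] ruling_face_crosspolytope[OF s]
    by (auto simp: crosspolytope_facets_def)
qed

lemma rulings_eqpoll_crosspolytope_facets:
  assumes "3 \<le> s" "s \<le> 8"
  shows "rulings s \<approx> crosspolytope_facets s"
  using bij_betw_ruling_face[OF assms] unfolding eqpoll_def by blast

lemma rulings_through_eqpoll_crosspolytope_facets:
  assumes s: "3 \<le> s" "s \<le> 8" and l: "l \<in> lines s"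
  shows "{f \<in> rulings s. ruling_contains s f l} \<approx> {X \<in> crosspolytope_facets s. vertex l \<in> X}"
proof -
  have "vertex l \<in> ruling_face s f \<longleftrightarrow> ruling_contains s f l" if "f \<in> rulings s" for f
    using that l s by (simp add: vertex_in_ruling_face_iff ruling_contains_iff inter_commute)
  then have "bij_betw (ruling_face s) {f \<in> rulings s. ruling_contains s f l}
      {X \<in> crosspolytope_facets s. vertex l \<in> X}"
    by (intro bij_betw_subset_filter bij_betw_ruling_face s)
  then show ?thesis
    unfolding eqpoll_def by blast
qed

theorem theorem17:
  fixes r :: nat and l :: "int ^ 9"
  assumes r: "4 \<le> r" "r \<le> 8"
    and l: "l \<in> lines r"
  shows
    "(N 0 l r \<approx> lines (r - 1) \<and>
      N 0 l r \<approx> {x. x extreme_point_of gosset (r - 1)}) \<and>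
     (N 1 l r \<approx> {f \<in> rulings r. ruling_contains r f l} \<and>
      {f \<in> rulings r. ruling_contains r f l} \<approx> rulings (r - 1) \<and>
      N 1 l r \<approx> {X \<in> crosspolytope_facets r. vertex l \<in> X} \<and>
      N 1 l r \<approx> crosspolytope_facets (r - 1)) \<and>
     (r = 8 \<longrightarrow>
      - (2 *s canon 8) - l \<in> lines 8 \<and>
      N 0 (- (2 *s canon 8) - l) 8 = {l' \<in> lines 8. skew l' (- (2 *s canon 8) - l)} \<and>
      N 2 l 8 \<approx> N 0 (- (2 *s canon 8) - l) 8 \<and>
      N 2 l 8 \<approx> lines 7) \<and>
     (r = 7 \<longrightarrow> N 2 l 7 = {- canon 7 - l}) \<and>
     (r = 8 \<longrightarrow> N 3 l 8 = {- (2 *s canon 8) - l})"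
proof (intro conjI impI)
  have r1: "3 \<le> r - 1" "r - 1 \<le> 8" "3 \<le> r"
    using r by auto
  show skew: "N 0 l r \<approx> lines (r - 1)"
    by (rule skew_lines_eqpoll_lines_pred[OF r l])
  show "N 0 l r \<approx> {x. x extreme_point_of gosset (r - 1)}"
    by (rule eqpoll_trans[OF skew lines_eqpoll_extreme_points[OF r1(2)]])
  show meet: "N 1 l r \<approx> {f \<in> rulings r. ruling_contains r f l}"
    by (rule meeting_lines_eqpoll_rulings[OF l])
  show rulings: "{f \<in> rulings r. ruling_contains r f l} \<approx> rulings (r - 1)"
    by (rule rulings_through_eqpoll_rulings_pred[OF r l])
  show "N 1 l r \<approx> {X \<in> crosspolytope_facets r. vertex l \<in> X}"
    by (rule eqpoll_trans[OF meet rulings_through_eqpoll_crosspolytope_facets[OF r1(3) r(2) l]])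
  show "N 1 l r \<approx> crosspolytope_facets (r - 1)"
    by (rule eqpoll_trans[OF eqpoll_trans[OF meet rulings]
          rulings_eqpoll_crosspolytope_facets[OF r1(1,2)]])
next
  assume "r = 8"
  then have l8: "l \<in> lines 8"
    using l by simp
  show m: "- (2 *s canon 8) - l \<in> lines 8"
    by (rule double_anticanonical_minus_line[OF l8])
  show "N 0 (- (2 *s canon 8) - l) 8 = {l' \<in> lines 8. skew l' (- (2 *s canon 8) - l)}"
    by (rule N_0_eq_skew[OF m])
  show "N 2 l 8 \<approx> N 0 (- (2 *s canon 8) - l) 8"
    by (simp add: N_2_eq_skew_lines[OF l8])
  show "N 2 l 8 \<approx> lines 7"
    using skew_lines_eqpoll_lines_pred[OF _ _ m] by (simp add: N_2_eq_skew_lines[OF l8])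
  show "N 3 l 8 = {- (2 *s canon 8) - l}"
    by (rule N_3_eq[OF l8])
next
  assume "r = 7"
  then show "N 2 l 7 = {- canon 7 - l}"
    using N_2_eq l by simp
qed

end
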